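(* Let $\lambda\neq 0$ be an algebraic number such that $M_\lambda<2$, and assume that $\lambda$ has no Galois conjugates (including $\lambda$ itself) on the unit circle. Then $h_\lambda<\log M_\lambda$.
   Context: Throughout $\log$ is the base $2$ logarithm. The Galois conjugates of $\lambda$ are the complex roots of its minimal polynomial. Mahler measure: if $\pi_\lambda=a_r\prod_{i=1}^r(X-\lambda_i)\in\mathbb{Z}[X]$ is the minimal polynomial (irreducible in $\mathbb{Z}[X]$) of the algebraic number $\lambda$, then $M_\lambda=|a_r|\prod_{|\lambda_i|>1}|\lambda_i|$. Let $\xi_0,\xi_1,\ldots$ be independent random variables, each equal to $+1$ or $-1$ with probability $1/2$, and let $\mu_\lambda^{(n)}$ be the law of the random variable $\sum_{i=0}^{n-1}\xi_i\lambda^i$. The entropy $h_\lambda$ is $$h_\lambda:=\lim_{n\to\infty}\frac{H(\mu_\lambda^{(n)})}{n},$$ where $H(\theta)=-\sum_x\theta(\{x\})\log\theta(\{x\})$ is the Shannon entropy of a discrete probability measure $\theta$. *)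

theory Defs
  imports "HOL-Probability.Probability" "Berlekamp_Zassenhaus.Mahler_Measure"
begin

hide_const (open) Module.smult UnivPoly.coeff UnivPoly.monom

text \<open>
  The minimal polynomial is taken in \<open>\<int>[X]\<close>: irreducibility there includes primitivity, so it is
  determined up to sign, and the sign is fixed by a positive leading coefficient.
\<close>

definition min_int_poly :: "complex \<Rightarrow> int poly" where
  "min_int_poly x =
     (THE p. irreducible p \<and> lead_coeff p > 0 \<and> poly (map_poly of_int p) x = 0)"

definition galois_conjugates :: "complex \<Rightarrow> complex set" where
  "galois_conjugates x = {z. poly (map_poly of_int (min_int_poly x)) z = 0}"

definition mahler_measure_of :: "complex \<Rightarrow> real" where
  "mahler_measure_of x = mahler_measure (min_int_poly x)"

lemma min_int_poly_ex1:
  fixes x :: complex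
  assumes "algebraic x"
  shows "\<exists>!p :: int poly. irreducible p \<and> lead_coeff p > 0 \<and> poly (map_poly of_int p) x = 0"
proof -
  define V where "V q \<longleftrightarrow> poly (map_poly of_int q :: complex poly) x = 0" for q :: "int poly"
  have V_mult: "V (p * q) \<longleftrightarrow> V p \<or> V q" for p q
    by (simp add: V_def of_int_poly_hom.hom_mult)
  have V_add: "V q" if "V (p + q)" "V p" for p q
    using that by (simp add: V_def of_int_poly_hom.hom_add)
  have V_const: "\<not> V [:c:]" if "c \<noteq> 0" for c
    using that by (simp add: V_def map_poly_pCons)
  obtain P :: "complex poly" where P: "\<And>i. coeff P i \<in> \<int>" "P \<noteq> 0" "poly P x = 0"
    using assms unfolding algebraic_def by blast
  have "\<exists>q :: int poly. q \<noteq> 0 \<and> V q"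
  proof -
    have "\<exists>q. P = map_poly of_int q"
    proof (intro exI poly_eqI)
      fix i
      have "coeff P i = of_int \<lfloor>Re (coeff P i)\<rfloor>"
        using P(1)[of i] by (auto elim!: Ints_cases)
      thus "coeff P i = coeff (map_poly of_int (map_poly (\<lambda>c. \<lfloor>Re c\<rfloor>) P)) i"
        by (simp add: coeff_map_poly)
    qed
    with P show ?thesis by (auto simp: V_def)
  qed
  then obtain m where m: "m \<noteq> 0" "V m" and min: "\<And>q. q \<noteq> 0 \<Longrightarrow> V q \<Longrightarrow> degree m \<le> degree q"
    using exists_least_iff[of "\<lambda>n. \<exists>q. q \<noteq> 0 \<and> V q \<and> degree q = n"] by (metis not_less)
  define r where "r = primitive_part m"
  have mr: "m = [:content m:] * r" by (simp add: r_def)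
  have r: "r \<noteq> 0" "V r" "degree r = degree m"
    using m V_mult[of "[:content m:]" r] V_const[of "content m"] by (auto simp: r_def)
  have r_dvd: "r dvd q" if q: "V q" for q
  proof -
    obtain a b where ab: "pseudo_divmod q r = (a, b)" by fastforce
    define c where "c = lead_coeff r ^ (Suc (degree q) - degree r)"
    have c0: "c \<noteq> 0" using r(1) by (simp add: c_def)
    have eq: "smult c q = r * a + b" and b: "b = 0 \<or> degree b < degree r"
      using pseudo_divmod[OF r(1) ab] by (auto simp: c_def)
    have "V ([:c:] * q)" using q V_mult by blast
    hence "V (r * a + b)" using eq by simp
    hence "V b" using V_add[of "r * a" b] V_mult r(2) by blast
    hence "b = 0" using b min[of b] r(3) by (metis not_less)
    hence eq': "smult c q = r * a" using eq by simp
    have "content r = 1" using m(1) by (simp add: r_def)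
    hence "content a = \<bar>c\<bar> * content q"
      using arg_cong[OF eq', of content] by (simp add: content_mult)
    hence "[:c:] dvd a" by (simp add: const_poly_dvd_iff_dvd_content)
    then obtain k where "a = [:c:] * k" by blast
    hence "smult c q = smult c (r * k)" using eq' by simp
    thus ?thesis using c0 by (metis dvd_triv_left smult_cancel)
  qed
  have r_irr: "irreducible r"
  proof (rule irreducibleI)
    show "\<not> r dvd 1"
    proof
      assume "r dvd 1"
      hence "V 1" using r(2) V_mult by (metis dvdE)
      thus False by (simp add: V_def)
    qed
  next
    fix a b assume ab: "r = a * b"
    have *: "b dvd 1" if "V a" "r = a * b" for a b
    proof -
      have "a * b dvd a * 1" using r_dvd[OF that(1)] that(2) by simp
      thus ?thesis using r(1) that(2) by (subst (asm) dvd_mult_cancel_left) auto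
    qed
    show "a dvd 1 \<or> b dvd 1"
      using *[OF _ ab] *[of b a] ab r(2) V_mult by (metis mult.commute)
  qed (rule r(1))
  define p where "p = (if lead_coeff r > 0 then r else - r)"
  have lr: "lead_coeff r \<noteq> 0" using r(1) by simp
  show ?thesis
  proof (rule ex1I[of _ p])
    have "V (- r)" using V_mult[of "[:- 1:]" r] r(2) by simp
    moreover have "irreducible (- r)"
      using r_irr by simp
    ultimately show "irreducible p \<and> lead_coeff p > 0 \<and> poly (map_poly of_int p) x = 0"
      using r(2) r_irr lr by (auto simp: p_def V_def)
  next
    fix q :: "int poly"
    assume q: "irreducible q \<and> lead_coeff q > 0 \<and> poly (map_poly of_int q) x = 0"
    hence "r dvd q" using r_dvd by (simp add: V_def)
    then obtain s where s: "q = r * s" by blast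
    have "s dvd 1" using q r_irr s by (metis irreducibleD irreducible_not_unit)
    then obtain c where c: "s = [:c:]" "c dvd 1" by (metis is_unit_poly_iff)
    hence "c = 1 \<or> c = -1" by auto
    thus "q = p" using q s c(1) lr by (auto simp: p_def)
  qed
qed

lemma mahler_measure_eq_prod_outside_unit_disc:
  "mahler_measure p = \<bar>of_int (lead_coeff p)\<bar> *
     (\<Prod>z\<in>#filter_mset (\<lambda>z. cmod z > 1) (proots (map_poly of_int p)). cmod z)"
proof (cases "p = 0")
  case False
  let ?q = "map_poly of_int p :: complex poly"
  let ?as = "complex_roots_complex ?q"
  have lc: "lead_coeff ?q = of_int (lead_coeff p)" by simp
  have eq: "?q = smult (lead_coeff ?q) (\<Prod>a\<leftarrow>?as. [:- a, 1:])"
    by (simp only: complex_roots)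
  have roots: "proots (\<Prod>a\<leftarrow>as. [:- a, 1:]) = mset as" for as :: "complex list"
  proof (induction as)
    case (Cons a as)
    have "(\<Prod>a\<leftarrow>as. [:- a, 1:]) \<noteq> 0" by (auto simp: prod_list_zero_iff)
    hence "proots (\<Prod>a\<leftarrow>a # as. [:- a, 1:]) = proots [:- a, 1:] + proots (\<Prod>a\<leftarrow>as. [:- a, 1:])"
      by (simp only: list.map prod_list.Cons) (rule proots_mult, simp_all)
    with Cons show ?case by (simp only: proots_linear_factor) simp
  qed simp
  have "lead_coeff ?q \<noteq> 0" using False by simp
  then have ms: "proots ?q = mset ?as"
    by (subst eq) (simp only: proots_smult[OF \<open>lead_coeff ?q \<noteq> 0\<close>] roots)
  have "(\<Prod>a\<leftarrow>as. max 1 (cmod a)) = (\<Prod>z\<in>#filter_mset (\<lambda>z. cmod z > 1) (mset as). cmod z)"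
    for as by (induction as) auto
  thus ?thesis
    unfolding mahler_measure_def mahler_measure_poly_def ms lc by (simp del: of_int_hom.hom_lead_coeff)
qed (simp add: mahler_measure_def mahler_measure_poly_def)

definition shannon_entropy :: "'a pmf \<Rightarrow> real" where
  "shannon_entropy \<theta> = - (\<Sum>\<^sub>\<infinity>x\<in>set_pmf \<theta>. pmf \<theta> x * log 2 (pmf \<theta> x))"

definition sign_sum_pmf :: "complex \<Rightarrow> nat \<Rightarrow> complex pmf" where
  "sign_sum_pmf x n =
     map_pmf (\<lambda>\<xi>. \<Sum>i<n. \<xi> i * x ^ i) (Pi_pmf {..<n} 0 (\<lambda>_. pmf_of_set {1, - 1}))"

text \<open>The limit exists because the entropies are subadditive in \<open>n\<close>.\<close>

definition entropy_rate :: "complex \<Rightarrow> real" where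
  "entropy_rate x = lim (\<lambda>n. shannon_entropy (sign_sum_pmf x n) / real n)"

end

theory Submission
  imports Defs "HOL-Real_Asymp.Real_Asymp"
begin

text \<open>
  Both the leading and the constant coefficient of the minimal polynomial \<open>p\<close> are bounded in
  modulus by the Mahler measure \<open>M\<close>, so \<open>M < 2\<close> forces them to be \<open>\<plusminus>1\<close>: \<open>\<lambda>\<close> is an algebraic unit, and
  by hypothesis multiplication by \<open>\<lambda>\<close> on \<open>\<int>[\<lambda>]\<close> is a hyperbolic automorphism of a lattice.

  Let \<open>X\<^sub>n\<close> be the random sign sum with \<open>n\<close> terms. All its conjugates at roots \<open>z\<close> of \<open>p\<close> have size
  \<open>O(max(1,|z|)\<^sup>n)\<close>, and a box of this shape contains only \<open>O(M\<^sup>n)\<close> elements of \<open>\<int>[\<lambda>]\<close>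
  (\<open>card_conjugate_box\<close>). Hence \<open>H(X\<^sub>n) \<le> n log M + O(1)\<close>. Entropy is subadditive along the sums,
  so the entropy rate is at most \<open>H(X\<^sub>n) / n\<close> for every \<open>n\<close> (\<open>entropy_rate_le\<close>), and it is enough to
  gain more than the additive constant for a single \<open>n\<close>. The gain comes from the arithmetic
  phenomenon that Erdos discovered for Pisot numbers: \<open>X\<^sub>n\<close> does not equidistribute, because there are
  characters whose Fourier coefficients do not decay.

  Such characters come from sequences \<open>y\<close> indexed by \<open>\<int>\<close> that satisfy the recurrence with
  characteristic polynomial \<open>p\<close> and tend to \<open>0\<close> modulo \<open>1\<close>, exponentially fast, in both directions
  (\<open>ex_homoclinic\<close>); in the language of torus automorphisms they are homoclinic points. A shift of
  \<open>y\<close> defines an additive map \<open>\<phi>\<close> on \<open>\<int>[\<lambda>]\<close> by \<open>\<phi> (\<lambda>\<^sup>i) = y (i + t)\<close>, and by independence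
  \<open>E cos (2\<pi> \<phi> X\<^sub>n)\<close> is a product of values \<open>cos (2\<pi> y j)\<close>. As soon as none of the cosines vanishes, all
  these products are bounded below by one positive constant, uniformly in \<open>n\<close> and in the shift.
  That \<open>y\<close> can be chosen with nonvanishing cosines is a counting argument: a vanishing cosine needs a
  rational value of \<open>y\<close>, and rational values are rare in a suitable one-parameter family
  (\<open>ex_homoclinic_cos_nonzero\<close>).

  Now take \<open>K\<close> shifts. The average \<open>Z\<close> of the corresponding characters, with appropriate signs, has
  expectation bounded below, so \<open>|Z|\<close> exceeds a constant on a set \<open>T\<close> of probability at least \<open>c\<close>.
  On the other hand the characters are nearly orthogonal with respect to counting measure on the
  box, as one sees by averaging over translations by multiples of \<open>\<lambda>\<^sup>k\<close> with \<open>k = n/2\<close>, which hardly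
  move the box. So \<open>T\<close> has only \<open>O(M\<^sup>n / K)\<close> elements (\<open>large_values_of_character_sum\<close>). A
  distribution on \<open>O(M\<^sup>n)\<close> points that gives mass \<open>c\<close> to \<open>O(M\<^sup>n / K)\<close> of them has entropy at most
  \<open>n log M + O(1) - c log K\<close>, and \<open>K\<close> can be taken as large as desired.
\<close>

section \<open>Entropy of finitely supported distributions\<close>

lemma shannon_entropy_finite:
  assumes "finite (set_pmf p)"
  shows "shannon_entropy p = - (\<Sum>x\<in>set_pmf p. pmf p x * log 2 (pmf p x))"
  using assms by (simp add: shannon_entropy_def)

lemma shannon_entropy_nonneg:
  assumes "finite (set_pmf p)"
  shows "shannon_entropy p \<ge> 0"
proof -
  have "(\<Sum>x\<in>set_pmf p. pmf p x * log 2 (pmf p x)) \<le> 0"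
    by (intro sum_nonpos mult_nonneg_nonpos) (auto simp: pmf_le_1 pmf_positive)
  then show ?thesis using assms by (simp add: shannon_entropy_finite)
qed

lemma gibbs_inequality:
  fixes q :: "'a \<Rightarrow> real"
  assumes fin: "finite (set_pmf p)"
    and q: "\<And>x. x \<in> set_pmf p \<Longrightarrow> q x > 0" "(\<Sum>x\<in>set_pmf p. q x) \<le> 1"
  shows "shannon_entropy p \<le> - (\<Sum>x\<in>set_pmf p. pmf p x * log 2 (q x))"
proof -
  have *: "pmf p x * log 2 (q x) - pmf p x * log 2 (pmf p x) \<le> (q x - pmf p x) / ln 2"
    if "x \<in> set_pmf p" for x
  proof -
    have px: "pmf p x > 0" and qx: "q x > 0" using that q by (auto simp: pmf_positive)
    have "pmf p x * (ln (q x / pmf p x)) \<le> pmf p x * (q x / pmf p x - 1)"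
      using px qx by (intro mult_left_mono ln_le_minus_one) auto
    also have "\<dots> = q x - pmf p x" using px by (simp add: field_simps)
    finally show ?thesis
      using px qx by (simp add: log_def ln_div field_simps)
  qed
  have "(\<Sum>x\<in>set_pmf p. pmf p x * log 2 (q x)) - (\<Sum>x\<in>set_pmf p. pmf p x * log 2 (pmf p x))
      \<le> (\<Sum>x\<in>set_pmf p. (q x - pmf p x) / ln 2)"
    unfolding sum_subtractf[symmetric] using * by (rule sum_mono)
  also have "\<dots> = ((\<Sum>x\<in>set_pmf p. q x) - 1) / ln 2"
    using fin by (simp add: sum_divide_distrib[symmetric] sum_subtractf sum_pmf_eq_1)
  also have "\<dots> \<le> 0" using q(2) by (simp add: divide_le_0_iff)
  finally show ?thesis using fin by (simp add: shannon_entropy_finite)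
qed

lemma shannon_entropy_pair:
  assumes "finite (set_pmf p)" "finite (set_pmf q)"
  shows "shannon_entropy (pair_pmf p q) = shannon_entropy p + shannon_entropy q"
proof -
  have "(\<Sum>x\<in>set_pmf p \<times> set_pmf q. pmf (pair_pmf p q) x * log 2 (pmf (pair_pmf p q) x))
     = (\<Sum>x\<in>set_pmf p. \<Sum>y\<in>set_pmf q. pmf (pair_pmf p q) (x,y) * log 2 (pmf (pair_pmf p q) (x,y)))"
    by (simp add: sum.cartesian_product)
  also have "\<dots> = (\<Sum>x\<in>set_pmf p. \<Sum>y\<in>set_pmf q. 
      pmf q y * (pmf p x * log 2 (pmf p x)) + pmf p x * (pmf q y * log 2 (pmf q y)))"
    by (intro sum.cong refl) (simp add: pmf_pair log_mult pmf_positive algebra_simps set_pmf_iff)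
  also have "\<dots> = (\<Sum>x\<in>set_pmf p. pmf p x * log 2 (pmf p x)) + (\<Sum>y\<in>set_pmf q. pmf q y * log 2 (pmf q y))"
    using assms by (simp add: sum.distrib sum_distrib_left[symmetric] sum_distrib_right[symmetric] sum_pmf_eq_1)
  finally show ?thesis using assms by (simp add: shannon_entropy_finite)
qed

lemma shannon_entropy_map_le:
  assumes fin: "finite (set_pmf p)"
  shows "shannon_entropy (map_pmf f p) \<le> shannon_entropy p"
proof -
  let ?q = "map_pmf f p"
  have le: "pmf p x \<le> pmf ?q (f x)" for x
  proof -
    have "pmf p x = measure p {x}" by (simp add: measure_pmf_single)
    also have "\<dots> \<le> measure p (f -` {f x})"
      by (intro measure_pmf.finite_measure_mono) auto
    finally show ?thesis by (simp add: pmf_map)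
  qed
  have eq: "pmf ?q y = (\<Sum>x\<in>{x\<in>set_pmf p. f x = y}. pmf p x)" for y
  proof -
    have "measure p (f -` {y}) = measure p {x\<in>set_pmf p. f x = y}"
      by (subst measure_Int_set_pmf[symmetric]) (auto intro!: arg_cong[where f="measure p"])
    then show ?thesis using fin by (simp add: pmf_map measure_measure_pmf_finite)
  qed
  have "(\<Sum>x\<in>set_pmf p. pmf p x * log 2 (pmf p x)) \<le> (\<Sum>x\<in>set_pmf p. pmf p x * log 2 (pmf ?q (f x)))"
    using le by (intro sum_mono mult_left_mono) (auto simp: pmf_positive intro!: log_mono)
  also have "\<dots> = (\<Sum>y\<in>f ` set_pmf p. \<Sum>x\<in>{x\<in>set_pmf p. f x = y}. pmf p x * log 2 (pmf ?q (f x)))"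
    using fin by (rule sum.image_gen)
  also have "\<dots> = (\<Sum>y\<in>set_pmf ?q. pmf ?q y * log 2 (pmf ?q y))"
  proof (intro sum.cong)
    fix y
    show "(\<Sum>x\<in>{x\<in>set_pmf p. f x = y}. pmf p x * log 2 (pmf ?q (f x))) = pmf ?q y * log 2 (pmf ?q y)"
      unfolding eq[of y] sum_distrib_right by (intro sum.cong) (auto simp: eq)
  qed auto
  finally show ?thesis using fin by (simp add: shannon_entropy_finite)
qed

text \<open>
  Mass concentrated on a small set \<open>T\<close> lowers the entropy by the mass times the logarithm of the
  size ratio. This is Gibbs' inequality for a comparison distribution that spreads one half of its
  mass evenly over \<open>T\<close> and the other half over the rest of \<open>S\<close>.
\<close>

lemma shannon_entropy_le_two_level:
  fixes S T :: "'a set" and a b :: real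
  assumes fin: "finite S" and supp: "set_pmf p \<subseteq> S" and T: "T \<subseteq> S"
    and a: "a > 0" "real (card S) \<le> a" and b: "b > 0" "real (card T) \<le> b"
  shows "shannon_entropy p \<le> 1 + log 2 a - measure (measure_pmf p) T * log 2 (a / b)"
proof -
  define q where "q x = (if x \<in> T then 1 / (2 * b) else 1 / (2 * a))" for x
  have finp: "finite (set_pmf p)" using fin supp finite_subset by blast
  have finT: "finite T" using fin T finite_subset by blast
  have qpos: "q x > 0" for x using a b by (simp add: q_def)
  have "(\<Sum>x\<in>set_pmf p. q x) \<le> (\<Sum>x\<in>S. q x)"
    using fin supp qpos by (intro sum_mono2) (auto intro: less_imp_le)
  also have "\<dots> = (\<Sum>x\<in>T. q x) + (\<Sum>x\<in>S - T. q x)"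
    using fin T by (simp add: sum.subset_diff add.commute)
  also have "\<dots> = real (card T) / (2 * b) + real (card (S - T)) / (2 * a)"
    by (simp add: q_def)
  also have "\<dots> \<le> 1/2 + 1/2"
  proof (rule add_mono)
    show "real (card T) / (2 * b) \<le> 1/2" using b by (simp add: field_simps)
    have "card (S - T) \<le> card S" using fin by (intro card_mono) auto
    then have "real (card (S - T)) \<le> a" using a by linarith
    then show "real (card (S - T)) / (2 * a) \<le> 1/2" using a by (simp add: field_simps)
  qed
  finally have "(\<Sum>x\<in>set_pmf p. q x) \<le> 1" by simp
  then have "shannon_entropy p \<le> - (\<Sum>x\<in>set_pmf p. pmf p x * log 2 (q x))"
    by (intro gibbs_inequality finp qpos)
  also have "(\<Sum>x\<in>set_pmf p. pmf p x * log 2 (q x))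
      = (\<Sum>x\<in>set_pmf p. pmf p x * (- 1 - log 2 a) + indicator T x * pmf p x * log 2 (a / b))"
    using a b by (intro sum.cong refl)
      (auto simp: q_def log_divide log_mult algebra_simps indicator_def)
  also have "\<dots> = (- 1 - log 2 a) + (\<Sum>x\<in>set_pmf p. indicator T x * pmf p x) * log 2 (a / b)"
    using finp by (simp add: sum.distrib sum_distrib_right[symmetric] sum_pmf_eq_1)
  also have "(\<Sum>x\<in>set_pmf p. indicator T x * pmf p x) = measure (measure_pmf p) T"
  proof -
    have "(\<Sum>x\<in>set_pmf p. indicator T x * pmf p x) = (\<Sum>x\<in>set_pmf p \<inter> T. pmf p x)"
      using finp by (simp add: indicator_def sum.inter_restrict if_distrib cong: if_cong)
    also have "\<dots> = measure (measure_pmf p) (T \<inter> set_pmf p)"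
      using finp by (simp add: measure_measure_pmf_finite Int_commute)
    finally show ?thesis by (simp add: measure_Int_set_pmf)
  qed
  finally show ?thesis by simp
qed

section \<open>Entropy of sign sums\<close>

lemma sign_sum_pmf_0: "sign_sum_pmf x 0 = return_pmf 0"
  by (simp add: sign_sum_pmf_def)

lemma sign_sum_pmf_Suc:
  "sign_sum_pmf x (Suc n) =
     map_pmf (\<lambda>(e, s). s + e * x ^ n) (pair_pmf (pmf_of_set {1, - 1}) (sign_sum_pmf x n))"
proof -
  have "(\<Sum>i<n. (if i = n then e else \<xi> i) * x ^ i) = (\<Sum>i<n. \<xi> i * x ^ i)" for e :: complex and \<xi>
    by (intro sum.cong) auto
  then show ?thesis
    unfolding sign_sum_pmf_def lessThan_Suc
    by (subst Pi_pmf_insert)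
       (auto simp: pmf.map_comp o_def pair_map_pmf2 case_prod_unfold fun_upd_def add.commute
             intro!: map_pmf_cong)
qed

lemma set_sign_pmf [simp]: "set_pmf (pmf_of_set {1, - 1 :: complex}) = {1, - 1}"
  by (intro set_pmf_of_set) auto

lemma finite_set_sign_sum_pmf: "finite (set_pmf (sign_sum_pmf x n))"
  by (induction n) (auto simp: sign_sum_pmf_0 sign_sum_pmf_Suc set_pair_pmf)

text \<open>
  The last \<open>n\<close> terms of a sum of length \<open>m + n\<close> are \<open>x ^ m\<close> times an independent copy of the sum of
  length \<open>n\<close>; this is the source of subadditivity.
\<close>

lemma sign_sum_pmf_add:
  "sign_sum_pmf x (m + n) =
     map_pmf (\<lambda>(a, b). a + x ^ m * b) (pair_pmf (sign_sum_pmf x m) (sign_sum_pmf x n))"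
proof (induction n)
  case 0
  show ?case by (simp add: sign_sum_pmf_0 pair_return_pmf2 pmf.map_comp o_def)
next
  case (Suc n)
  have "sign_sum_pmf x (m + Suc n)
     = bind_pmf (pmf_of_set {1, -1}) (\<lambda>e. bind_pmf (sign_sum_pmf x m) (\<lambda>a.
         bind_pmf (sign_sum_pmf x n) (\<lambda>b. return_pmf (a + x ^ m * b + e * x ^ (m + n)))))"
    by (simp add: sign_sum_pmf_Suc Suc map_pmf_def pair_pmf_def bind_assoc_pmf bind_return_pmf)
  also have "\<dots> = bind_pmf (sign_sum_pmf x m) (\<lambda>a. bind_pmf (pmf_of_set {1, -1}) (\<lambda>e. 
         bind_pmf (sign_sum_pmf x n) (\<lambda>b. return_pmf (a + x ^ m * b + e * x ^ (m + n)))))"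
    by (rule bind_commute_pmf)
  also have "\<dots> = map_pmf (\<lambda>(a, b). a + x ^ m * b) (pair_pmf (sign_sum_pmf x m) (sign_sum_pmf x (Suc n)))"
    by (simp add: sign_sum_pmf_Suc map_pmf_def pair_pmf_def bind_assoc_pmf bind_return_pmf
          power_add algebra_simps)
  finally show ?case .
qed

lemma shannon_entropy_sign_sum_subadditive:
  "shannon_entropy (sign_sum_pmf x (m + n))
     \<le> shannon_entropy (sign_sum_pmf x m) + shannon_entropy (sign_sum_pmf x n)"
  unfolding sign_sum_pmf_add
  by (rule order.trans[OF shannon_entropy_map_le])
     (auto simp: shannon_entropy_pair finite_set_sign_sum_pmf set_pair_pmf)

lemma fekete:
  fixes f :: "nat \<Rightarrow> real"
  assumes sub: "\<And>m n. f (m + n) \<le> f m + f n" and nonneg: "\<And>n. f n \<ge> 0"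
  shows "(\<lambda>n. f n / real n) \<longlonglongrightarrow> (INF n\<in>{1..}. f n / real n)"
proof -
  define L where "L = (INF n\<in>{1..}. f n / real n)"
  have bdd: "bdd_below ((\<lambda>n. f n / real n) ` {1..})"
    using nonneg by (intro bdd_belowI[of _ 0]) auto
  have L_le: "L \<le> f n / real n" if "n \<ge> 1" for n
    unfolding L_def using that by (intro cINF_lower bdd) auto
  have mult: "f (q * m + r) \<le> real q * f m + f r" for q m r
  proof (induction q)
    case (Suc q)
    have "f (Suc q * m + r) \<le> f m + f (q * m + r)" using sub[of m "q * m + r"] by (simp add: add.assoc)
    with Suc show ?case by (simp add: algebra_simps)
  qed simp
  show ?thesis
    unfolding L_def[symmetric]
  proof (rule LIMSEQ_I)
    fix e :: real assume e: "e > 0"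
    have "\<exists>x\<in>(\<lambda>n. f n / real n) ` {1..}. x < L + e / 2"
      unfolding L_def using e by (intro cInf_lessD) auto
    then obtain m where m: "m \<ge> 1" "f m / real m < L + e / 2" by auto
    define B where "B = (\<Sum>r<m. f r)"
    have B: "f r \<le> B" if "r < m" for r
      unfolding B_def using that nonneg by (intro member_le_sum) auto
    obtain N :: nat where N: "real N > 2 * B / e" using reals_Archimedean2 by blast
    show "\<exists>no. \<forall>n\<ge>no. norm (f n / real n - L) < e"
    proof (intro exI allI impI)
      fix n assume n: "n \<ge> Suc N"
      have n0: "real n > 0" using n by simp
      have "f n \<le> real (n div m) * f m + f (n mod m)" using mult[of "n div m" m "n mod m"] by simp
      also have "\<dots> \<le> (real n / real m) * f m + B"
        using m B nonneg of_nat_div_le_of_nat[of n m] by (intro add_mono mult_right_mono) auto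
      finally have "f n / real n \<le> ((real n / real m) * f m + B) / real n"
        using n0 by (simp add: divide_right_mono)
      also have "\<dots> = f m / real m + B / real n" using n0 by (simp add: field_simps)
      also have "B / real n < e / 2"
      proof -
        have "2 * B / e < real n" using N n by simp
        then show ?thesis using e n0 by (simp add: field_simps)
      qed
      finally have "f n / real n < L + e" using m by linarith
      moreover have "L \<le> f n / real n" using L_le n by simp
      ultimately show "norm (f n / real n - L) < e" by simp
    qed
  qed
qed

lemma entropy_rate_le:
  assumes "n \<ge> 1"
  shows "entropy_rate x \<le> shannon_entropy (sign_sum_pmf x n) / real n"
proof -
  let ?h = "\<lambda>n. shannon_entropy (sign_sum_pmf x n)"
  have nonneg: "?h n \<ge> 0" for n by (intro shannon_entropy_nonneg finite_set_sign_sum_pmf)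
  have "(\<lambda>n. ?h n / real n) \<longlonglongrightarrow> (INF n\<in>{1..}. ?h n / real n)"
    by (rule fekete[OF shannon_entropy_sign_sum_subadditive nonneg])
  then have "entropy_rate x = (INF n\<in>{1..}. ?h n / real n)"
    unfolding entropy_rate_def by (rule limI)
  also have "\<dots> \<le> ?h n / real n"
    using assms nonneg by (intro cINF_lower bdd_belowI[of _ 0]) auto
  finally show ?thesis .
qed

section \<open>Lagrange interpolation\<close>

definition lagrange :: "'a::field set \<Rightarrow> 'a \<Rightarrow> 'a poly" where
  "lagrange A a = (\<Prod>b\<in>A - {a}. smult (1 / (a - b)) [:- b, 1:])"

lemma poly_lagrange:
  assumes "finite A" "b \<in> A"
  shows "poly (lagrange A a) b = (if a = b then 1 else 0)"
proof -
  have "poly (lagrange A a) b = (\<Prod>c\<in>A - {a}. (b - c) / (a - c))"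
    unfolding lagrange_def poly_prod by (intro prod.cong) (auto simp: diff_divide_distrib)
  also have "\<dots> = (if a = b then 1 else 0)"
    using assms by (auto intro!: prod.neutral prod_zero)
  finally show ?thesis .
qed

lemma degree_lagrange_less:
  assumes "finite A" "a \<in> A"
  shows "degree (lagrange A a) < card A"
proof -
  have "degree (lagrange A a) \<le> (\<Sum>b\<in>A - {a}. degree (smult (1 / (a - b)) [:- b, 1:]))"
    unfolding lagrange_def using assms
    by (intro order.trans[OF degree_prod_sum_le]) (simp_all only: o_def finite_Diff order.refl)
  also have "\<dots> \<le> (\<Sum>b\<in>A - {a}. 1)"
    by (intro sum_mono order.trans[OF degree_smult_le]) simp
  also have "\<dots> = card A - 1" using assms by simp
  finally show ?thesis using assms card_gt_0_iff[of A] by fastforce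
qed

lemma lagrange_interpolation:
  fixes f :: "'a::field poly"
  assumes A: "finite A" and deg: "degree f < card A"
  shows "f = (\<Sum>a\<in>A. smult (poly f a) (lagrange A a))"
proof (rule poly_eqI_degree[of A])
  fix b assume b: "b \<in> A"
  have "poly (\<Sum>a\<in>A. smult (poly f a) (lagrange A a)) b = (\<Sum>a\<in>A. if a = b then poly f a else 0)"
    unfolding poly_sum by (intro sum.cong) (auto simp: poly_lagrange A b)
  then show "poly f b = poly (\<Sum>a\<in>A. smult (poly f a) (lagrange A a)) b"
    using A b by simp
next
  have "degree (smult (poly f a) (lagrange A a)) \<le> card A - 1" if "a \<in> A" for a
    using degree_lagrange_less[OF A that] degree_smult_le[of "poly f a" "lagrange A a"] by linarith
  then have "degree (\<Sum>a\<in>A. smult (poly f a) (lagrange A a)) \<le> card A - 1"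
    by (intro degree_sum_le A)
  then show "degree (\<Sum>a\<in>A. smult (poly f a) (lagrange A a)) < card A" using deg by linarith
qed (fact deg)

lemma Rats_coeff_lagrange:
  fixes A :: "real set"
  assumes "A \<subseteq> \<rat>" "a \<in> A"
  shows "coeff (lagrange A a) i \<in> \<rat>"
proof -
  have "coeff (\<Prod>b\<in>B. smult (1 / (a - b)) [:- b, 1:]) i \<in> \<rat>" if "B \<subseteq> A" for B i
    using that
  proof (induction B arbitrary: i rule: infinite_finite_induct)
    case (insert b B)
    then have b: "b \<in> \<rat>" "a \<in> \<rat>" using assms by auto
    have "coeff (smult (1 / (a - b)) [:- b, 1:]) j \<in> \<rat>" for j
      using b by (auto simp: coeff_pCons split: nat.split)
    then show ?case using insert
      by (simp only: prod.insert insert.hyps if_False coeff_mult) (intro Rats_sum Rats_mult, auto)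
  qed (auto simp: coeff_1)
  then show ?thesis by (simp add: lagrange_def)
qed

text \<open>
  Used in the contrapositive: a polynomial of degree below \<open>r\<close> with an irrational coefficient has
  fewer than \<open>r\<close> rational values at rational points.
\<close>

lemma Rats_coeff_if_Rats_values:
  fixes f :: "real poly"
  assumes "finite A" "A \<subseteq> \<rat>" "degree f < card A" "\<And>a. a \<in> A \<Longrightarrow> poly f a \<in> \<rat>"
  shows "coeff f i \<in> \<rat>"
proof -
  have "coeff f i = (\<Sum>a\<in>A. poly f a * coeff (lagrange A a) i)"
    by (subst lagrange_interpolation[OF assms(1,3)]) (simp add: coeff_sum)
  also have "\<dots> \<in> \<rat>" using assms by (intro Rats_sum Rats_mult Rats_coeff_lagrange) auto
  finally show ?thesis .
qed

section \<open>Roots of irreducible integer polynomials\<close>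

text \<open>
  Some irreducible factor of \<open>q\<close> vanishes at \<open>z\<close>, and up to sign there is only one irreducible integer
  polynomial that does.
\<close>

lemma irreducible_int_poly_dvd:
  fixes p q :: "int poly" and z :: complex
  assumes p: "irreducible p" "poly (of_int_poly p) z = 0"
    and q: "poly (of_int_poly q) z = 0"
  shows "p dvd q"
proof (cases "q = 0")
  case False
  have pos: "\<exists>s'. irreducible s' \<and> lead_coeff s' > 0 \<and> poly (of_int_poly s') z = 0 \<and> s' dvd s \<and> s dvd s'"
    if s: "irreducible s" "poly (of_int_poly s) z = 0" for s :: "int poly"
  proof (cases "lead_coeff s > 0")
    case False
    have "lead_coeff s \<noteq> 0" using s(1) by auto
    then have "lead_coeff (- s) > 0" using False unfolding degree_minus coeff_minus by linarith
    then show ?thesis using s by (intro exI[of _ "- s"]) (auto simp: of_int_poly_hom.hom_uminus)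
  qed (use s in auto)
  have alg: "algebraic z"
    unfolding algebraic_def using p by (intro exI[of _ "of_int_poly p"]) auto
  have "\<exists>s. irreducible s \<and> s dvd q \<and> poly (of_int_poly s) z = 0"
  proof -
    have "q dvd prod_mset (prime_factorization q)"
      by (rule associatedD2[OF prod_mset_prime_factorization_weak[OF False]])
    then obtain k where k: "prod_mset (prime_factorization q) = q * k" by blast
    have "poly (of_int_poly (prod_mset (prime_factorization q))) z = 0"
      unfolding k using q by (simp add: of_int_poly_hom.hom_mult)
    moreover have "\<exists>s\<in>#N. poly (of_int_poly s) z = 0"
      if "poly (of_int_poly (prod_mset N)) z = 0" for N :: "int poly multiset"
      using that by (induction N) (auto simp: of_int_poly_hom.hom_mult)
    ultimately obtain s where s: "s \<in># prime_factorization q" "poly (of_int_poly s) z = 0" by blast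
    have "irreducible s"
      using in_prime_factors_imp_prime[OF s(1)] by (intro prime_elem_imp_irreducible prime_imp_prime_elem)
    then show ?thesis using in_prime_factors_imp_dvd[OF s(1)] s(2) by blast
  qed
  then obtain s where s: "irreducible s" "s dvd q" "poly (of_int_poly s) z = 0" by blast
  obtain s' where s': "irreducible s'" "lead_coeff s' > 0" "poly (of_int_poly s') z = 0" "s' dvd s"
    using pos[OF s(1,3)] by blast
  obtain p' where p': "irreducible p'" "lead_coeff p' > 0" "poly (of_int_poly p') z = 0" "p dvd p'"
    using pos[OF p] by blast
  have "s' = p'" using min_int_poly_ex1[OF alg] s' p' by blast
  then show ?thesis using s' p' s dvd_trans by blast
qed simp

text \<open>
  A common root of \<open>p\<close> and its derivative would make \<open>p\<close> divide a nonzero polynomial of smaller degree.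
\<close>

lemma rsquarefree_irreducible_int_poly:
  fixes p :: "int poly"
  assumes p: "irreducible p"
  shows "rsquarefree (of_int_poly p :: complex poly)"
  unfolding rsquarefree_roots
proof (intro allI notI; elim conjE)
  fix z :: complex
  assume z: "poly (of_int_poly p) z = 0" "poly (pderiv (of_int_poly p)) z = 0"
  have "p dvd pderiv p"
    by (rule irreducible_int_poly_dvd[OF p z(1)]) (use z(2) in \<open>simp add: of_int_hom.map_poly_pderiv\<close>)
  moreover have deg: "degree p > 0"
  proof (rule ccontr)
    assume "\<not> degree p > 0"
    then obtain c where "p = [:c:]" by (auto elim: degree_eq_zeroE)
    moreover have "p \<noteq> 0" using p by auto
    ultimately show False using z(1) by simp
  qed
  moreover from deg have "pderiv p \<noteq> 0" by (auto simp: pderiv_eq_0_iff)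
  ultimately show False using dvd_imp_degree_le[of p "pderiv p"] by (simp add: degree_pderiv)
qed

definition int_poly_roots :: "int poly \<Rightarrow> complex set" where
  "int_poly_roots p = {z. poly (of_int_poly p) z = 0}"

lemma finite_int_poly_roots: "p \<noteq> 0 \<Longrightarrow> finite (int_poly_roots p)"
  unfolding int_poly_roots_def by (rule poly_roots_finite) auto

lemma card_int_poly_roots:
  assumes "irreducible p"
  shows "card (int_poly_roots p) = degree p"
proof -
  let ?q = "of_int_poly p :: complex poly"
  have nz: "?q \<noteq> 0" using assms by auto
  have "degree ?q = degree (smult (lead_coeff ?q) (\<Prod>z|poly ?q z = 0. [:-z, 1:]))"
    by (subst complex_poly_decompose_rsquarefree[OF rsquarefree_irreducible_int_poly[OF assms]]) simp
  also have "\<dots> = (\<Sum>z|poly ?q z = 0. degree [:-z, 1:])"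
    using nz by (simp del: of_int_hom.hom_lead_coeff add: degree_prod_sum_eq)
  finally show ?thesis by (simp add: int_poly_roots_def)
qed

lemma mahler_measure_irreducible:
  assumes "irreducible p"
  shows "mahler_measure p = \<bar>of_int (lead_coeff p)\<bar> * (\<Prod>z\<in>int_poly_roots p. max 1 (cmod z))"
proof -
  let ?q = "of_int_poly p :: complex poly"
  let ?R = "int_poly_roots p"
  have nz: "?q \<noteq> 0" using assms by auto
  have fin: "finite ?R" using assms by (intro finite_int_poly_roots) auto
  have "proots ?q = mset_set ?R"
  proof (rule multiset_eqI)
    fix z show "count (proots ?q) z = count (mset_set ?R) z"
      using rsquarefree_root_order[OF rsquarefree_irreducible_int_poly[OF assms], of z] fin nz
      by (cases "z \<in> ?R") (auto simp: int_poly_roots_def order_root count_proots order_0I)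
  qed
  then have "mahler_measure p = \<bar>of_int (lead_coeff p)\<bar> *
     (\<Prod>z\<in>#filter_mset (\<lambda>z. cmod z > 1) (mset_set ?R). cmod z)"
    by (simp add: mahler_measure_eq_prod_outside_unit_disc)
  also have "(\<Prod>z\<in>#filter_mset (\<lambda>z. cmod z > 1) (mset_set ?R). cmod z)
      = (\<Prod>z\<in>{z\<in>?R. cmod z > 1}. cmod z)"
    using fin by (simp add: filter_mset_mset_set prod_unfold_prod_mset)
  also have "\<dots> = (\<Prod>z\<in>?R. if cmod z > 1 then cmod z else 1)"
    using fin by (simp add: prod.inter_filter)
  also have "\<dots> = (\<Prod>z\<in>?R. max 1 (cmod z))" by (intro prod.cong) auto
  finally show ?thesis .
qed

text \<open>
  The leading coefficient and the constant coefficient, which is up to sign the leading coefficient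
  times the product of all roots, are nonzero integers of modulus at most the Mahler measure.
\<close>

lemma irreducible_int_poly_unit:
  fixes p :: "int poly"
  assumes irr: "irreducible p" and lc: "lead_coeff p > 0" and M: "mahler_measure p < 2"
    and z0: "poly (of_int_poly p) lam = 0" "lam \<noteq> (0::complex)"
  shows "lead_coeff p = 1" "\<bar>coeff p 0\<bar> = 1"
proof -
  let ?q = "of_int_poly p :: complex poly"
  let ?R = "int_poly_roots p"
  have max1: "(\<Prod>z\<in>?R. max 1 (cmod z)) \<ge> 1" by (intro prod_ge_1) auto
  have "of_int (lead_coeff p) * 1 \<le> of_int (lead_coeff p) * (\<Prod>z\<in>?R. max 1 (cmod z))"
    using lc by (intro mult_left_mono max1) auto
  also have "\<dots> = mahler_measure p" using lc by (simp add: mahler_measure_irreducible[OF irr])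
  finally have "of_int (lead_coeff p) < (2::real)" using M by simp
  then show lc1: "lead_coeff p = 1" using lc by simp
  have "?q = (\<Prod>z\<in>?R. [:-z, 1:])"
    using complex_poly_decompose_rsquarefree[OF rsquarefree_irreducible_int_poly[OF irr]] lc1
    by (simp add: int_poly_roots_def)
  then have "poly ?q 0 = (\<Prod>z\<in>?R. - z)" by (simp add: poly_prod)
  then have "cmod (of_int (coeff p 0)) = (\<Prod>z\<in>?R. cmod z)"
    by (simp add: poly_0_coeff_0 prod_norm[symmetric])
  also have "\<dots> \<le> (\<Prod>z\<in>?R. max 1 (cmod z))" by (intro prod_mono) auto
  also have "\<dots> < 2" using M lc1 by (simp add: mahler_measure_irreducible[OF irr])
  finally have "\<bar>coeff p 0\<bar> < 2" by (simp flip: of_int_abs)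
  moreover have "coeff p 0 \<noteq> 0"
  proof
    assume "coeff p 0 = 0"
    then have "poly (of_int_poly p) (0::complex) = 0" by (simp add: poly_0_coeff_0)
    then have "p dvd [:0, 1:]" by (rule irreducible_int_poly_dvd[OF irr]) simp
    then obtain k where "[:0, 1:] = p * k" by blast
    then have "of_int_poly [:0, 1:] = (of_int_poly p * of_int_poly k :: complex poly)"
      by (metis of_int_poly_hom.hom_mult)
    then have "poly (of_int_poly [:0, 1:]) lam = 0" using z0 by simp
    then show False using z0 by simp
  qed
  ultimately show "\<bar>coeff p 0\<bar> = 1" by linarith
qed

section \<open>Counting algebraic integers with bounded conjugates\<close>

lemma cnj_of_int_poly: "poly (of_int_poly P) (cnj z) = cnj (poly (of_int_poly P :: complex poly) z)"
  by (subst poly_cnj_real) auto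

lemma cnj_int_poly_roots: "z \<in> int_poly_roots p \<Longrightarrow> cnj z \<in> int_poly_roots p"
  by (simp add: int_poly_roots_def cnj_of_int_poly)

text \<open>
  One real coordinate for each root: in a pair of complex conjugate roots the upper one records the
  real part and the lower one the imaginary part of the common value. Using both parts at each root
  would square the contribution of the complex roots to the count below.
\<close>

definition half_coord :: "complex \<Rightarrow> int poly \<Rightarrow> real" where
  "half_coord z P = (if Im z \<ge> 0 then Re (poly (of_int_poly P) z) else Im (poly (of_int_poly P) z))"

lemma half_coord_diff: "half_coord z (P - Q) = half_coord z P - half_coord z Q"
  by (simp add: half_coord_def of_int_poly_hom.hom_minus)

lemma abs_half_coord_le: "\<bar>half_coord z P\<bar> \<le> cmod (poly (of_int_poly P) z)"
  by (simp add: half_coord_def abs_Re_le_cmod abs_Im_le_cmod)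

text \<open>
  The missing real or imaginary part of the value at \<open>z\<close> is recorded, up to sign, at the conjugate root,
  and for real \<open>z\<close> the imaginary part is zero.
\<close>

lemma cmod_le_half_coords:
  assumes "\<bar>half_coord z P\<bar> < e" "\<bar>half_coord (cnj z) P\<bar> < e"
  shows "cmod (poly (of_int_poly P) z) \<le> 2 * e"
proof -
  let ?w = "poly (of_int_poly P) z"
  have cn: "poly (of_int_poly P) (cnj z) = cnj ?w" by (rule cnj_of_int_poly)
  have e: "e > 0" using assms by linarith
  have real: "Im ?w = 0" if "Im z = 0"
  proof -
    have "cnj z = z" using that by (simp add: complex_eq_iff)
    then have "cnj ?w = ?w" using cn by simp
    then show ?thesis by (simp add: complex_eq_iff)
  qed
  have "\<bar>Re ?w\<bar> < e \<and> \<bar>Im ?w\<bar> < e"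
    using assms real cn e by (cases "Im z" "0::real" rule: linorder_cases) (auto simp: half_coord_def)
  then show ?thesis using cmod_le[of ?w] by linarith
qed

text \<open>
  The remainder of \<open>P\<close> modulo \<open>p\<close> has the same values at the roots, and interpolation bounds its
  integer coefficients by these values; small values therefore force it to vanish.
\<close>

lemma vanishes_if_small_at_conjugates:
  assumes irr: "irreducible p" and monic: "lead_coeff p = 1" 
  shows "\<exists>e>0. \<forall>P. (\<forall>z\<in>int_poly_roots p. cmod (poly (of_int_poly P) z) \<le> e) \<longrightarrow> p dvd P"
proof -
  let ?R = "int_poly_roots p"
  have p0: "p \<noteq> 0" using irr by auto
  have fin: "finite ?R" using p0 by (rule finite_int_poly_roots)
  define B where "B = (\<Sum>z\<in>?R. \<Sum>i<degree p. cmod (coeff (lagrange ?R z) i))"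
  have B0: "B \<ge> 0" unfolding B_def by (intro sum_nonneg) auto
  show ?thesis
  proof (intro exI[of _ "1 / (B + 1)"] conjI allI impI)
    fix P assume small: "\<forall>z\<in>?R. cmod (poly (of_int_poly P) z) \<le> 1 / (B + 1)"
    obtain a b where ab: "pseudo_divmod P p = (a, b)" by fastforce
    have P: "P = p * a + b" and degb: "b = 0 \<or> degree b < degree p"
      using pseudo_divmod[OF p0 ab] monic by auto
    have val: "poly (of_int_poly b) z = poly (of_int_poly P) z" if "z \<in> ?R" for z
      using that unfolding P by (simp add: int_poly_roots_def of_int_poly_hom.hom_add of_int_poly_hom.hom_mult)
    have "b = 0"
    proof (rule ccontr)
      assume "b \<noteq> 0"
      then have deg: "degree (of_int_poly b :: complex poly) < card ?R"
        using degb by (simp add: card_int_poly_roots[OF irr])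
      have "coeff b i = 0" if i: "i < degree p" for i
      proof -
        have "of_int (coeff b i) = coeff (of_int_poly b :: complex poly) i" by simp
        also have "\<dots> = (\<Sum>z\<in>?R. poly (of_int_poly P) z * coeff (lagrange ?R z) i)"
          by (subst lagrange_interpolation[OF fin deg]) (simp add: coeff_sum val)
        finally have "cmod (of_int (coeff b i)) \<le> (\<Sum>z\<in>?R. cmod (poly (of_int_poly P) z * coeff (lagrange ?R z) i))"
          by (simp add: norm_sum)
        also have "\<dots> \<le> (\<Sum>z\<in>?R. 1 / (B + 1) * (\<Sum>i<degree p. cmod (coeff (lagrange ?R z) i)))"
          unfolding norm_mult using i small B0
          by (intro sum_mono mult_mono member_le_sum) (auto intro: sum_nonneg)
        also have "\<dots> = B / (B + 1)" by (simp add: B_def flip: sum_divide_distrib)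
        also have "\<dots> < 1" using B0 by simp
        finally have "\<bar>coeff b i\<bar> < 1" by (simp flip: of_int_abs)
        then show ?thesis by linarith
      qed
      then show False using \<open>b \<noteq> 0\<close> degb leading_coeff_0_iff by blast
    qed
    then show "p dvd P" using P by simp
  qed (use B0 in auto)
qed

lemma card_int_interval_le:
  assumes "x \<ge> (0::real)"
  shows "real (card {- \<lceil>x\<rceil>..\<lceil>x\<rceil>}) \<le> 2 * x + 3"
proof -
  have "\<lceil>x\<rceil> \<ge> 0" using assms by simp
  then show ?thesis using ceiling_correct[of x] by (simp add: of_nat_nat)
qed

definition conjugate_box :: "int poly \<Rightarrow> complex \<Rightarrow> real \<Rightarrow> nat \<Rightarrow> complex set" where
  "conjugate_box p lam C n = {poly (of_int_poly P) lam | P.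
     \<forall>z\<in>int_poly_roots p. cmod (poly (of_int_poly P) z) \<le> C * max 1 (cmod z) ^ n}"

text \<open>
  Divide the range of each half coordinate into intervals of a fixed small length. Two elements in
  the same cell coincide, because their difference is small at all conjugates, and the number of
  cells is the product over the roots of \<open>O(max(1,|z|)\<^sup>n)\<close>.
\<close>

lemma card_conjugate_box:
  assumes irr: "irreducible p" and monic: "lead_coeff p = 1" and lam: "lam \<in> int_poly_roots p"
    and C: "C \<ge> 0"
  shows "\<exists>D>0. \<forall>n. finite (conjugate_box p lam C n) \<and>
           real (card (conjugate_box p lam C n)) \<le> D * (\<Prod>z\<in>int_poly_roots p. max 1 (cmod z)) ^ n"
proof -
  let ?R = "int_poly_roots p"
  have fin: "finite ?R" using irr by (intro finite_int_poly_roots) auto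
  obtain e0 where e0: "e0 > 0"
    "\<And>P. (\<And>z. z \<in> ?R \<Longrightarrow> cmod (poly (of_int_poly P) z) \<le> e0) \<Longrightarrow> p dvd P"
    using vanishes_if_small_at_conjugates[OF irr monic] by blast
  define e where "e = e0 / 2"
  have e: "e > 0" using e0 by (simp add: e_def)
  have sep: "p dvd P" if "\<And>z. z \<in> ?R \<Longrightarrow> \<bar>half_coord z P\<bar> < e" for P
    using cmod_le_half_coords[of _ P e] that cnj_int_poly_roots[of _ p]
    by (intro e0(2)) (auto simp: e_def)
  define D where "D = (2 * C / e + 3) ^ card ?R"
  show ?thesis
  proof (intro exI[of _ D] conjI allI)
    show "D > 0" using C e by (auto simp: D_def intro!: zero_less_power add_nonneg_pos)
    fix n
    let ?X = "conjugate_box p lam C n"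
    have "\<exists>P. poly (of_int_poly P) lam = x \<and> (\<forall>z\<in>?R. cmod (poly (of_int_poly P) z) \<le> C * max 1 (cmod z) ^ n)"
      if "x \<in> ?X" for x using that by (auto simp: conjugate_box_def)
    then obtain P where P: "\<And>x. x \<in> ?X \<Longrightarrow> poly (of_int_poly (P x)) lam = x"
      "\<And>x z. x \<in> ?X \<Longrightarrow> z \<in> ?R \<Longrightarrow> cmod (poly (of_int_poly (P x)) z) \<le> C * max 1 (cmod z) ^ n"
      by metis
    define K where "K z = {- \<lceil>C * max 1 (cmod z) ^ n / e\<rceil> .. \<lceil>C * max 1 (cmod z) ^ n / e\<rceil>}" for z
    define cell where "cell x = (\<lambda>z\<in>?R. \<lfloor>half_coord z (P x) / e\<rfloor>)" for x
    have range: "cell ` ?X \<subseteq> PiE ?R K"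
    proof (intro image_subsetI PiE_I)
      fix x z assume x: "x \<in> ?X" and z: "z \<in> ?R"
      have "\<bar>half_coord z (P x)\<bar> \<le> C * max 1 (cmod z) ^ n"
        using abs_half_coord_le[of z "P x"] P(2)[OF x z] by linarith
      then have "half_coord z (P x) / e \<le> C * max 1 (cmod z) ^ n / e"
        "- (C * max 1 (cmod z) ^ n / e) \<le> half_coord z (P x) / e"
        using e by (auto simp: field_simps)
      then show "cell x z \<in> K z" using z
        unfolding cell_def K_def by (simp add: le_floor_iff ceiling_minus floor_le_iff) linarith
    qed (auto simp: cell_def)
    have inj: "inj_on cell ?X"
    proof (rule inj_onI)
      fix x y assume x: "x \<in> ?X" and y: "y \<in> ?X" and eq: "cell x = cell y"
      have "p dvd P x - P y"
      proof (rule sep)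
        fix z assume z: "z \<in> ?R"
        have "\<lfloor>half_coord z (P x) / e\<rfloor> = \<lfloor>half_coord z (P y) / e\<rfloor>"
          using fun_cong[OF eq, of z] z by (simp add: cell_def)
        then have "\<bar>half_coord z (P x) / e - half_coord z (P y) / e\<bar> < 1" by linarith
        then show "\<bar>half_coord z (P x - P y)\<bar> < e"
          using e by (simp add: half_coord_diff diff_divide_distrib[symmetric])
      qed
      then obtain k where k: "P x - P y = p * k" by blast
      have "x - y = poly (of_int_poly (P x - P y)) lam"
        using P(1) x y by (simp add: of_int_poly_hom.hom_minus)
      also have "\<dots> = 0" unfolding k using lam by (simp add: int_poly_roots_def of_int_poly_hom.hom_mult)
      finally show "x = y" by simp
    qed
    have finPi: "finite (PiE ?R K)" using fin by (intro finite_PiE) (auto simp: K_def)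
    show "finite ?X" using finite_imageD[OF finite_subset[OF range finPi] inj] .
    have "real (card ?X) = real (card (cell ` ?X))" by (simp add: card_image inj)
    also have "\<dots> \<le> real (card (PiE ?R K))" using card_mono[OF finPi range] by simp
    also have "\<dots> = (\<Prod>z\<in>?R. real (card (K z)))" by (simp add: card_PiE[OF fin])
    also have "\<dots> \<le> (\<Prod>z\<in>?R. (2 * C / e + 3) * max 1 (cmod z) ^ n)"
    proof (intro prod_mono conjI)
      fix z
      have ge1: "1 \<le> max 1 (cmod z) ^ n" by (intro one_le_power) auto
      have "real (card (K z)) \<le> 2 * (C * max 1 (cmod z) ^ n / e) + 3"
        unfolding K_def using C e by (intro card_int_interval_le) auto
      also have "\<dots> \<le> (2 * C / e + 3) * max 1 (cmod z) ^ n" using ge1 by (simp add: algebra_simps)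
      finally show "real (card (K z)) \<le> (2 * C / e + 3) * max 1 (cmod z) ^ n" .
    qed auto
    also have "\<dots> = D * (\<Prod>z\<in>?R. max 1 (cmod z)) ^ n"
      by (simp add: prod.distrib D_def prod_power_distrib)
    finally show "real (card ?X) \<le> D * (\<Prod>z\<in>?R. max 1 (cmod z)) ^ n" .
  qed
qed

section \<open>Linear recurrences and additive functionals\<close>

definition recurrent :: "int poly \<Rightarrow> (int \<Rightarrow> 'a::comm_ring_1) \<Rightarrow> bool" where
  "recurrent p a \<longleftrightarrow> (\<forall>j. (\<Sum>i\<le>degree p. of_int (coeff p i) * a (j + int i)) = 0)"

definition pairing :: "(int \<Rightarrow> 'a::comm_ring_1) \<Rightarrow> int poly \<Rightarrow> 'a" where
  "pairing a P = (\<Sum>i\<le>degree P. of_int (coeff P i) * a (int i))"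

lemma pairing_altdef: "degree P \<le> n \<Longrightarrow> pairing a P = (\<Sum>i\<le>n. of_int (coeff P i) * a (int i))"
  unfolding pairing_def by (intro sum.mono_neutral_left) (auto simp: coeff_eq_0)

lemma pairing_add: "pairing a (P + Q) = pairing a P + pairing a Q"
proof -
  define n where "n = max (degree P) (degree Q)"
  have "degree (P + Q) \<le> n" by (simp add: n_def degree_add_le_max)
  moreover have "degree P \<le> n" "degree Q \<le> n" by (auto simp: n_def)
  ultimately show ?thesis
    by (simp add: pairing_altdef[where n = n] sum.distrib algebra_simps)
qed

lemma pairing_smult: "pairing a (smult c P) = of_int c * pairing a P"
  by (simp add: pairing_altdef[where n = "degree P"] degree_smult_le sum_distrib_left mult.assoc)

lemma pairing_pCons_0: "pairing a (pCons 0 P) = pairing (\<lambda>j. a (j + 1)) P"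
  by (subst pairing_altdef[where n = "Suc (degree P)"], simp add: degree_pCons_le)
     (subst sum.atMost_Suc_shift, simp add: pairing_def add.commute)

lemma pairing_monom: "pairing a (monom 1 n) = a (int n)"
proof -
  have "pairing a (monom 1 n) = (\<Sum>i\<le>n. of_int (coeff (monom 1 n) i) * a (int i))"
    by (rule pairing_altdef) (rule degree_monom_le)
  also have "\<dots> = (\<Sum>i\<le>n. if i = n then a (int i) else 0)"
    by (intro sum.cong) auto
  finally have "pairing a (monom 1 n) = (\<Sum>i\<le>n. if i = n then a (int i) else 0)" .
  then show ?thesis by simp
qed

lemma recurrentD: "recurrent p a \<Longrightarrow> (\<Sum>i\<le>degree p. of_int (coeff p i) * a (j + int i)) = 0"
  by (simp add: recurrent_def)

lemma recurrent_shift: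
  assumes "recurrent p a"
  shows "recurrent p (\<lambda>j. a (j + k))"
  unfolding recurrent_def
proof
  fix j
  show "(\<Sum>i\<le>degree p. of_int (coeff p i) * a (j + int i + k)) = 0"
    using recurrentD[OF assms, of "j + k"] by (simp only: add.commute add.left_commute)
qed

lemma pairing_multiple:
  assumes "recurrent p a"
  shows "pairing a (p * q) = 0"
  using assms
proof (induction q arbitrary: a rule: pCons_induct)
  case 0
  show ?case by (simp add: pairing_def)
next
  case (pCons c q)
  have "pairing a p = 0" using recurrentD[OF pCons.prems, of 0] by (simp add: pairing_def)
  moreover have "pairing (\<lambda>j. a (j + 1)) (p * q) = 0"
    by (rule pCons.IH[OF recurrent_shift[OF pCons.prems]])
  ultimately show ?case
    by (simp add: mult_pCons_right pairing_add pairing_smult pairing_pCons_0)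
qed

definition int_span :: "complex \<Rightarrow> complex set" where
  "int_span lam = range (\<lambda>P. poly (of_int_poly P) lam)"

text \<open>
  The pairing with a solution of the recurrence annihilates the multiples of \<open>p\<close>, which are exactly
  the integer polynomials vanishing at \<open>lam\<close>. Prescribing the values on the powers of \<open>lam\<close> by a
  solution of the recurrence is therefore consistent.
\<close>

lemma ex_additive_extension:
  fixes a :: "int \<Rightarrow> 'a::comm_ring_1"
  assumes irr: "irreducible p" and lam: "lam \<in> int_poly_roots p" and a: "recurrent p a"
  shows "\<exists>\<phi>. (\<forall>x\<in>int_span lam. \<forall>y\<in>int_span lam. \<phi> (x + y) = \<phi> x + \<phi> y) \<and>
           (\<forall>n. \<phi> (lam ^ n) = a (int n))"
proof -
  define \<phi> where "\<phi> x = pairing a (SOME P. poly (of_int_poly P) lam = x)" for x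
  have wd: "\<phi> (poly (of_int_poly P) lam) = pairing a P" for P
  proof -
    define Q where "Q = (SOME Q. poly (of_int_poly Q) lam = poly (of_int_poly P) lam)"
    have "poly (of_int_poly Q) lam = poly (of_int_poly P) lam"
      unfolding Q_def by (rule someI[of _ P]) simp
    then have "p dvd Q - P"
      using irr lam unfolding int_poly_roots_def
      by (intro irreducible_int_poly_dvd[of p lam]) (auto simp: of_int_poly_hom.hom_minus)
    then obtain k where "Q = P + p * k" by (metis add.commute diff_add_cancel dvdE)
    then have "pairing a Q = pairing a P" by (simp add: pairing_add pairing_multiple[OF a])
    then show ?thesis by (simp add: \<phi>_def Q_def)
  qed
  show ?thesis
  proof (intro exI[of _ \<phi>] conjI allI ballI)
    fix x y assume "x \<in> int_span lam" "y \<in> int_span lam"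
    then obtain P Q where xy: "x = poly (of_int_poly P) lam" "y = poly (of_int_poly Q) lam"
      by (auto simp: int_span_def)
    show "\<phi> (x + y) = \<phi> x + \<phi> y"
      using wd[of "P + Q"] by (simp add: xy wd pairing_add of_int_poly_hom.hom_add)
  next
    fix n show "\<phi> (lam ^ n) = a (int n)"
      using wd[of "monom 1 n"] by (simp add: pairing_monom poly_monom)
  qed
qed

section \<open>Homoclinic solutions\<close>

text \<open>
  Since both end coefficients are \<open>\<plusminus>1\<close>, the recurrence can be solved with integer coefficients for
  its last and for its first term, so it can be run in both directions without leaving \<open>S\<close>.
\<close>

lemma recurrent_window_propagates:
  fixes a :: "int \<Rightarrow> 'a::comm_ring_1"
  assumes rec: "recurrent p a" and monic: "lead_coeff p = 1" and const: "\<bar>coeff p 0\<bar> = 1"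
    and deg: "degree p > 0"
    and S: "0 \<in> S" "\<And>x y. x \<in> S \<Longrightarrow> y \<in> S \<Longrightarrow> x + y \<in> S" "\<And>c x. x \<in> S \<Longrightarrow> of_int c * x \<in> S"
    and window: "\<And>i. i < degree p \<Longrightarrow> a (j + int i) \<in> S"
  shows "a k \<in> S"
proof -
  define W where "W j \<longleftrightarrow> (\<forall>i<degree p. a (j + int i) \<in> S)" for j
  have sumS: "(\<Sum>i\<in>A. f i) \<in> S" if "\<And>i. i \<in> A \<Longrightarrow> f i \<in> S" for A and f :: "nat \<Rightarrow> 'a"
    using that by (induction A rule: infinite_finite_induct) (auto intro: S)
  have neg: "- x \<in> S" if "x \<in> S" for x using S(3)[OF that, of "-1"] by simp
  have up: "W (j + 1)" if "W j" for j
    unfolding W_def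
  proof (intro allI impI)
    fix i assume i: "i < degree p"
    show "a (j + 1 + int i) \<in> S"
    proof (cases "Suc i < degree p")
      case True
      then have "a (j + int (Suc i)) \<in> S" using that unfolding W_def by blast
      then show ?thesis by (simp add: algebra_simps)
    next
      case False
      then have r: "degree p = Suc i" using i by simp
      have "a (j + int (degree p)) = - (\<Sum>i<degree p. of_int (coeff p i) * a (j + int i))"
        using recurrentD[OF rec, of j] monic by (simp add: lessThan_Suc_atMost[symmetric] eq_neg_iff_add_eq_0 add.commute)
      also have "\<dots> \<in> S" using that by (intro neg sumS S) (auto simp: W_def)
      finally show ?thesis using r by (simp add: algebra_simps)
    qed
  qed
  have down: "W (j - 1)" if "W j" for j
    unfolding W_def
  proof (intro allI impI)
    fix i assume i: "i < degree p"
    show "a (j - 1 + int i) \<in> S"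
    proof (cases i)
      case (Suc i')
      then have "a (j + int i') \<in> S" using that i unfolding W_def by simp
      then show ?thesis using Suc by (simp add: algebra_simps)
    next
      case 0
      obtain r where r: "degree p = Suc r" using deg by (cases "degree p") auto
      have "of_int (coeff p 0) * a (j - 1) = - (\<Sum>i<degree p. of_int (coeff p (Suc i)) * a (j + int i))"
        using recurrentD[OF rec, of "j - 1"] unfolding r sum.atMost_Suc_shift
        by (simp add: lessThan_Suc_atMost eq_neg_iff_add_eq_0 algebra_simps)
      also have "\<dots> \<in> S" using that by (intro neg sumS S) (auto simp: W_def)
      finally have "of_int (coeff p 0) * (of_int (coeff p 0) * a (j - 1)) \<in> S" by (rule S)
      moreover have "coeff p 0 = 1 \<or> coeff p 0 = -1" using const by linarith
      ultimately have "a (j - 1) \<in> S" by auto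
      then show ?thesis using 0 by simp
    qed
  qed
  have "W j" using window by (simp add: W_def)
  then have "W k"
    by (induction k rule: int_induct[where k = j]) (auto intro: up down)
  then have "a (k + int 0) \<in> S" using deg unfolding W_def by blast
  then show ?thesis by simp
qed

lemma recurrent_zero_window:
  fixes a :: "int \<Rightarrow> 'a::comm_ring_1"
  assumes rec: "recurrent p a" and monic: "lead_coeff p = 1" and const: "\<bar>coeff p 0\<bar> = 1"
    and deg: "degree p > 0"
    and window: "\<And>i. i < degree p \<Longrightarrow> a (j + int i) = 0"
  shows "a k = 0"
  using recurrent_window_propagates[OF rec monic const deg, of "{0}" j k] window by auto

lemma Ints_small_zero: "x \<in> \<int> \<Longrightarrow> \<bar>x\<bar> < (1::real) \<Longrightarrow> x = 0"
  by (auto elim!: Ints_cases)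

lemma ex_power_small:
  assumes "0 < \<rho>" "\<rho> < (1::real)" "e > 0"
  shows "\<exists>K::nat. \<forall>k\<ge>K. C * \<rho> ^ k < e"
proof -
  have "(\<lambda>k. C * \<rho> ^ k) \<longlonglongrightarrow> C * 0"
    using assms by (intro tendsto_intros LIMSEQ_power_zero) auto
  then have "eventually (\<lambda>k. C * \<rho> ^ k < e) sequentially"
    using assms by (intro order_tendstoD(2)[where y = "C * 0"]) auto
  then show ?thesis by (simp add: eventually_sequentially)
qed

text \<open>
  Modulo \<open>1\<close> these are the coordinate sequences of homoclinic points of the torus automorphism with
  characteristic polynomial \<open>p\<close>. In the direction of positive indices the values themselves decay,
  while in the negative direction only their distance to the integers does.
\<close>

definition homoclinic :: "int poly \<Rightarrow> real \<Rightarrow> real \<Rightarrow> (int \<Rightarrow> real) \<Rightarrow> bool" where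
  "homoclinic p C \<rho> y \<longleftrightarrow> recurrent p y \<and> (\<forall>j\<ge>0. \<bar>y j\<bar> \<le> C * \<rho> ^ nat j) \<and>
     (\<forall>j. \<exists>g\<in>\<int>. \<bar>y j - g\<bar> \<le> C * \<rho> ^ nat \<bar>j\<bar>)"

text \<open>
  The solution \<open>\<Sum>z. c z * z powi j\<close> of the recurrence with initial values \<open>1, 0, \<dots>, 0\<close> consists of
  integers. Its part over the roots inside the unit disc decays in the positive direction; in the
  negative direction it differs from an integer by the part over the roots outside, which decays
  there. No root lies on the circle, so nothing is left over.
\<close>

lemma ex_homoclinic:
  assumes irr: "irreducible p" and monic: "lead_coeff p = 1" and const: "\<bar>coeff p 0\<bar> = 1"
    and deg: "degree p > 0" and hyp: "\<And>z. z \<in> int_poly_roots p \<Longrightarrow> cmod z \<noteq> 1"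
  shows "\<exists>w C \<rho>. 0 < \<rho> \<and> \<rho> < 1 \<and> C \<ge> 0 \<and> homoclinic p C \<rho> w \<and> (\<exists>j. w j \<noteq> 0)"
proof -
  let ?R = "int_poly_roots p"
  have p0: "p \<noteq> 0" using irr by auto
  have fin: "finite ?R" using p0 by (rule finite_int_poly_roots)
  have card: "card ?R = degree p" by (rule card_int_poly_roots[OF irr])
  have nz: "z \<noteq> 0" if "z \<in> ?R" for z
    using that const by (auto simp: int_poly_roots_def poly_0_coeff_0)
  define c where "c z = coeff (lagrange ?R z) 0" for z
  define g where "g A j = (\<Sum>z\<in>A. c z * z powi j)" for A j
  have rec_g: "recurrent p (g A)" if A: "A \<subseteq> ?R" for A
    unfolding recurrent_def
  proof
    fix j
    have "(\<Sum>i\<le>degree p. of_int (coeff p i) * g A (j + int i))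
        = (\<Sum>z\<in>A. \<Sum>i\<le>degree p. of_int (coeff p i) * (c z * z powi (j + int i)))"
      unfolding g_def sum_distrib_left by (rule sum.swap)
    also have "\<dots> = (\<Sum>z\<in>A. c z * z powi j * poly (of_int_poly p) z)"
    proof (intro sum.cong refl)
      fix z assume "z \<in> A"
      then have "z powi (j + int i) = z powi j * z ^ i" for i
        using nz A by (subst power_int_add) auto
      then show "(\<Sum>i\<le>degree p. of_int (coeff p i) * (c z * z powi (j + int i)))
          = c z * z powi j * poly (of_int_poly p) z"
        by (simp add: poly_altdef sum_distrib_left mult_ac)
    qed
    also have "\<dots> = 0" using A by (intro sum.neutral) (auto simp: int_poly_roots_def)
    finally show "(\<Sum>i\<le>degree p. of_int (coeff p i) * g A (j + int i)) = 0" .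
  qed
  have g_init: "g ?R (int i) = (if i = 0 then 1 else 0)" if i: "i < degree p" for i
  proof -
    have d: "degree (monom 1 i :: complex poly) < card ?R" using i card by (simp add: degree_monom_eq)
    have "coeff (monom 1 i) 0 = (\<Sum>z\<in>?R. z ^ i * c z)"
      by (subst lagrange_interpolation[OF fin d]) (simp add: coeff_sum poly_monom c_def)
    then show ?thesis by (auto simp: g_def mult.commute)
  qed
  have g_int: "g ?R k \<in> \<int>" for k
    by (rule recurrent_window_propagates[OF rec_g monic const deg, where j = 0])
       (auto simp: g_init intro: Ints_mult)
  define w where "w j = Re (g {z\<in>?R. cmod z < 1} j)" for j
  define v where "v j = Re (g {z\<in>?R. cmod z > 1} j)" for j
  have recRe: "recurrent p (\<lambda>j. Re (a j))" if "recurrent p a" for a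
    unfolding recurrent_def
  proof
    fix j
    have "(\<Sum>i\<le>degree p. of_int (coeff p i) * Re (a (j + int i)))
        = Re (\<Sum>i\<le>degree p. of_int (coeff p i) * a (j + int i))" by simp
    then show "(\<Sum>i\<le>degree p. of_int (coeff p i) * Re (a (j + int i))) = 0"
      by (simp only: recurrentD[OF that] zero_complex.sel)
  qed
  have wv: "w j + v j = Re (g ?R j)" for j
  proof -
    have "cmod z < 1 \<or> cmod z > 1" if "z \<in> ?R" for z using hyp[OF that] by linarith
    then have "?R = {z\<in>?R. cmod z < 1} \<union> {z\<in>?R. cmod z > 1}" by blast
    then have "g ?R j = g ({z\<in>?R. cmod z < 1} \<union> {z\<in>?R. cmod z > 1}) j" by simp
    also have "\<dots> = g {z\<in>?R. cmod z < 1} j + g {z\<in>?R. cmod z > 1} j"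
      unfolding g_def using fin by (intro sum.union_disjoint) auto
    finally show ?thesis by (simp add: w_def v_def)
  qed
  have Re_int: "Re (g ?R j) \<in> \<int>" for j using g_int[of j] by (auto elim!: Ints_cases)
  \<comment> \<open>the entry \<open>1/2\<close> only keeps the maximum positive\<close>
  define \<rho> where "\<rho> = Max (insert (1/2) ((\<lambda>z. min (cmod z) (1 / cmod z)) ` ?R))"
  have fin': "finite (insert (1/2) ((\<lambda>z. min (cmod z) (1 / cmod z)) ` ?R))" using fin by simp
  have \<rho>0: "\<rho> > 0"
    using Max_ge[OF fin', of "1/2"] unfolding \<rho>_def by simp
  have \<rho>1: "\<rho> < 1"
  proof -
    have "min (cmod z) (1 / cmod z) < 1" if "z \<in> ?R" for z
      using hyp[OF that] nz[OF that] by (cases "cmod z" "1::real" rule: linorder_cases) (auto simp: min_less_iff_disj)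
    then show ?thesis unfolding \<rho>_def using fin by (subst Max_less_iff) auto
  qed
  have \<rho>_ge: "min (cmod z) (1 / cmod z) \<le> \<rho>" if "z \<in> ?R" for z
    unfolding \<rho>_def using that by (intro Max_ge fin') auto
  define C where "C = (\<Sum>z\<in>?R. cmod (c z))"
  have C0: "C \<ge> 0" unfolding C_def by (intro sum_nonneg) auto
  have bound: "\<bar>Re (g A j)\<bar> \<le> C * \<rho> ^ n" if A: "A \<subseteq> ?R" "\<And>z. z \<in> A \<Longrightarrow> cmod (z powi j) \<le> \<rho> ^ n" for A j n
  proof -
    have "\<bar>Re (g A j)\<bar> \<le> cmod (g A j)" by (rule abs_Re_le_cmod)
    also have "\<dots> \<le> (\<Sum>z\<in>A. cmod (c z) * cmod (z powi j))"
      unfolding g_def by (rule order.trans[OF norm_sum]) (simp add: norm_mult)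
    also have "\<dots> \<le> (\<Sum>z\<in>A. cmod (c z) * \<rho> ^ n)" by (intro sum_mono mult_left_mono A) auto
    also have "\<dots> \<le> (\<Sum>z\<in>?R. cmod (c z) * \<rho> ^ n)"
      using fin A \<rho>0 by (intro sum_mono2) auto
    finally show ?thesis by (simp add: C_def sum_distrib_right)
  qed
  have w_bound: "\<bar>w j\<bar> \<le> C * \<rho> ^ nat j" if "j \<ge> 0" for j
    unfolding w_def
  proof (rule bound)
    fix z assume z: "z \<in> {z\<in>?R. cmod z < 1}"
    have "cmod z \<le> 1 / cmod z" using z nz by (simp add: field_simps mult_le_one)
    then have "cmod z \<le> \<rho>" using \<rho>_ge[of z] z by simp
    then have "cmod z ^ nat j \<le> \<rho> ^ nat j" by (intro power_mono) auto
    then show "cmod (z powi j) \<le> \<rho> ^ nat j" using that by (simp add: power_int_def norm_power)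
  qed auto
  have v_bound: "\<bar>v j\<bar> \<le> C * \<rho> ^ nat \<bar>j\<bar>" if "j \<le> 0" for j
    unfolding v_def
  proof (rule bound)
    fix z assume z: "z \<in> {z\<in>?R. cmod z > 1}"
    then have "1 / cmod z < 1" by (subst divide_less_eq_1_pos) auto
    then have "1 / cmod z \<le> cmod z" using z by simp
    then have "1 / cmod z \<le> \<rho>" using \<rho>_ge[of z] z by simp
    then have "(1 / cmod z) ^ nat \<bar>j\<bar> \<le> \<rho> ^ nat \<bar>j\<bar>" by (intro power_mono) auto
    moreover have "cmod (z powi j) = (1 / cmod z) ^ nat \<bar>j\<bar>"
      unfolding inverse_eq_divide[symmetric] norm_inverse[symmetric] norm_power[symmetric]
      using that by (cases "j = 0") (simp_all only: power_int_def, simp_all)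
    ultimately show "cmod (z powi j) \<le> \<rho> ^ nat \<bar>j\<bar>" by simp
  qed auto
  have near: "\<exists>g\<in>\<int>. \<bar>w j - g\<bar> \<le> C * \<rho> ^ nat \<bar>j\<bar>" for j
  proof (cases "j \<ge> 0")
    case True
    then show ?thesis using w_bound[OF True] by (intro bexI[of _ 0]) auto
  next
    case False
    have "w j - Re (g ?R j) = - v j" using wv[of j] by simp
    then show ?thesis using v_bound[of j] False Re_int[of j] by (intro bexI[of _ "Re (g ?R j)"]) auto
  qed
  have nonzero: "\<exists>j. w j \<noteq> 0"
  proof (rule ccontr)
    assume "\<not> (\<exists>j. w j \<noteq> 0)"
    then have vg: "v j = Re (g ?R j)" for j using wv[of j] by simp
    obtain K where K: "\<And>k. k \<ge> K \<Longrightarrow> C * \<rho> ^ k < 1"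
      using ex_power_small[OF \<rho>0 \<rho>1, of 1 C] by auto
    have "Re (g ?R (- int (K + degree p) + int i)) = 0" if "i < degree p" for i
    proof (rule Ints_small_zero[OF Re_int])
      have "\<bar>v (- int (K + degree p) + int i)\<bar> \<le> C * \<rho> ^ nat \<bar>- int (K + degree p) + int i\<bar>"
        using that by (intro v_bound) auto
      also have "\<dots> < 1" using that by (intro K) linarith
      finally show "\<bar>Re (g ?R (- int (K + degree p) + int i))\<bar> < 1" by (simp add: vg)
    qed
    then have "Re (g ?R 0) = 0"
      by (rule recurrent_zero_window[OF recRe[OF rec_g[OF order.refl]] monic const deg])
    then show False using g_init[of 0] deg by simp
  qed
  have "recurrent p w" unfolding w_def by (intro recRe rec_g) auto
  then have hom: "homoclinic p C \<rho> w" unfolding homoclinic_def using w_bound near by simp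
  show ?thesis
    by (rule exI[of _ w], rule exI[of _ C], rule exI[of _ \<rho>], intro conjI \<rho>0 \<rho>1 C0 hom nonzero)
qed

text \<open>
  The values decay, so if \<open>0\<close> is isolated among them, a whole window of them vanishes.
\<close>

lemma homoclinic_eq_zero:
  assumes y: "homoclinic p C \<rho> y" and \<rho>: "0 < \<rho>" "\<rho> < 1" and monic: "lead_coeff p = 1" and const: "\<bar>coeff p 0\<bar> = 1"
    and deg: "degree p > 0" and e: "e > 0"
    and small: "\<And>j. j \<ge> 0 \<Longrightarrow> \<bar>y j\<bar> < e \<Longrightarrow> y j = 0"
  shows "y k = 0"
proof -
  obtain K where K: "\<And>k. k \<ge> K \<Longrightarrow> C * \<rho> ^ k < e" using ex_power_small[OF \<rho> e] by blast
  have rec: "recurrent p y" and dec: "\<And>j. j \<ge> 0 \<Longrightarrow> \<bar>y j\<bar> \<le> C * \<rho> ^ nat j"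
    using y by (auto simp: homoclinic_def)
  have "y (int K + int i) = 0" for i
  proof (rule small)
    have "\<bar>y (int K + int i)\<bar> \<le> C * \<rho> ^ nat (int K + int i)" by (rule dec) simp
    also have "\<dots> < e" by (rule K) simp
    finally show "\<bar>y (int K + int i)\<bar> < e" .
  qed simp
  then show ?thesis by (rule recurrent_zero_window[OF rec monic const deg])
qed

lemma common_denominator:
  fixes A :: "real set"
  assumes "finite A" "A \<subseteq> \<rat>"
  shows "\<exists>d::int. d > 0 \<and> (\<forall>x\<in>A. of_int d * x \<in> \<int>)"
  using assms
proof (induction A rule: finite_induct)
  case (insert a A)
  then obtain d where d: "d > 0" "\<forall>x\<in>A. of_int d * x \<in> \<int>" by auto
  obtain m n :: int where mn: "n > 0" "a = of_int m / of_int n" using insert.prems by (auto elim!: Rats_cases')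
  show ?case
  proof (intro exI[of _ "d * n"] conjI ballI)
    fix x assume "x \<in> insert a A"
    then consider "x = a" | "x \<in> A" by auto
    then show "of_int (d * n) * x \<in> \<int>"
    proof cases
      case 2
      then have "of_int n * (of_int d * x) \<in> \<int>" using d by (intro Ints_mult[OF Ints_of_int[of n]]) blast
      then show ?thesis by (simp add: mult_ac)
    qed (use mn in auto)
  qed (use d mn in auto)
qed (auto intro: exI[of _ 1])

text \<open>
  If a whole window were rational, a common denominator would work for all values by propagation,
  making \<open>0\<close> an isolated value.
\<close>

lemma homoclinic_window_irrational:
  assumes w: "homoclinic p C \<rho> w" and \<rho>: "0 < \<rho>" "\<rho> < 1" and monic: "lead_coeff p = 1" and const: "\<bar>coeff p 0\<bar> = 1"
    and deg: "degree p > 0" and nz: "w k \<noteq> 0"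
  shows "\<exists>i<degree p. w (j + int i) \<notin> \<rat>"
proof (rule ccontr)
  assume "\<not> ?thesis"
  then have "(\<lambda>i. w (j + int i)) ` {..<degree p} \<subseteq> \<rat>" by auto
  then obtain d :: int where d: "d > 0" "\<And>i. i < degree p \<Longrightarrow> of_int d * w (j + int i) \<in> \<int>"
    using common_denominator[of "(\<lambda>i. w (j + int i)) ` {..<degree p}"] by auto
  have int: "of_int d * w l \<in> \<int>" for l
  proof -
    have "w l \<in> {x. of_int d * x \<in> \<int>}"
    proof (rule recurrent_window_propagates[OF _ monic const deg])
      show "recurrent p w" using w by (simp add: homoclinic_def)
      fix c x assume "x \<in> {x::real. of_int d * x \<in> \<int>}"
      then have "of_int c * (of_int d * x) \<in> \<int>" by (intro Ints_mult[OF Ints_of_int[of c]]) blast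
      then show "of_int c * x \<in> {x. of_int d * x \<in> \<int>}" by (simp add: mult_ac)
    qed (use d in \<open>auto simp: distrib_left\<close>)
    then show ?thesis by simp
  qed
  have "w k = 0"
  proof (rule homoclinic_eq_zero[OF w \<rho> monic const deg, of "1 / of_int d"])
    fix l assume "\<bar>w l\<bar> < 1 / of_int d"
    then have "\<bar>of_int d * w l\<bar> < 1" using d(1) by (simp add: abs_mult field_simps)
    then have "of_int d * w l = 0" by (intro Ints_small_zero int)
    then show "w l = 0" using d(1) by simp
  qed (use d in auto)
  then show False using nz by simp
qed

lemma power_mult_power_tendsto_0:
  assumes "0 < \<rho>" "\<rho> < (1::real)"
  shows "(\<lambda>J. B * (real J + 1) ^ r * \<rho> ^ J) \<longlonglongrightarrow> 0"
  using assms by real_asymp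

lemma cos_two_pi_zero:
  assumes "cos (2 * pi * x) = 0"
  shows "x \<in> \<rat>" and "g \<in> \<int> \<Longrightarrow> \<bar>x - g\<bar> \<ge> 1 / 4"
proof -
  obtain i :: int where i: "odd i" "2 * pi * x = of_int i * (pi / 2)"
    using assms unfolding cos_zero_iff_int by blast
  then have x: "x = of_int i / 4" by (simp add: field_simps)
  show "x \<in> \<rat>" unfolding x by simp
  assume "g \<in> \<int>"
  then obtain k where k: "g = of_int k" by (auto elim: Ints_cases)
  have "i - 4 * k \<noteq> 0" using i(1) by presburger
  then have "\<bar>of_int (i - 4 * k)\<bar> \<ge> (1::real)" by linarith
  then show "\<bar>x - g\<bar> \<ge> 1 / 4" unfolding x k by (simp add: field_simps)
qed

text \<open>
  The sums are the values at \<open>m\<close> of the polynomial with coefficients \<open>a i\<close>, one of which is irrational.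
\<close>

lemma card_rational_moments_less:
  fixes a :: "nat \<Rightarrow> real"
  assumes r: "\<exists>i<r. a i \<notin> \<rat>" and fin: "finite A"
  shows "card {m\<in>A. (\<Sum>i<r. real m ^ i * a i) \<in> \<rat>} < r"
proof (rule ccontr)
  let ?A = "{m\<in>A. (\<Sum>i<r. real m ^ i * a i) \<in> \<rat>}"
  assume "\<not> card ?A < r"
  then have ge: "r \<le> card (real ` ?A)" by (simp add: card_image)
  define f where "f = (\<Sum>i<r. monom (a i) i)"
  have cf: "coeff f i = (if i < r then a i else 0)" for i
    by (simp add: f_def coeff_sum)
  have r0: "r > 0" using r by auto
  have "degree f \<le> r - 1" by (rule degree_le) (auto simp: cf)
  then have "degree f < card (real ` ?A)" using ge r0 by linarith
  moreover have "poly f (real m) = (\<Sum>i<r. real m ^ i * a i)" for m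
    by (simp add: f_def poly_sum poly_monom mult.commute)
  ultimately have "coeff f i \<in> \<rat>" for i
    using fin by (intro Rats_coeff_if_Rats_values[of "real ` ?A"]) auto
  then show False using r cf by (metis (full_types))
qed

lemma recurrent_sum:
  assumes "\<And>i. i \<in> A \<Longrightarrow> recurrent p (f i)"
  shows "recurrent p (\<lambda>j. \<Sum>i\<in>A. c i * f i j)"
  unfolding recurrent_def
proof
  fix j
  have "(\<Sum>l\<le>degree p. of_int (coeff p l) * (\<Sum>i\<in>A. c i * f i (j + int l)))
      = (\<Sum>i\<in>A. c i * (\<Sum>l\<le>degree p. of_int (coeff p l) * f i (j + int l)))"
    unfolding sum_distrib_left by (subst sum.swap) (simp add: mult_ac)
  also have "\<dots> = 0" using assms by (intro sum.neutral) (simp add: recurrent_def)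
  finally show "(\<Sum>l\<le>degree p. of_int (coeff p l) * (\<Sum>i\<in>A. c i * f i (j + int l))) = 0" .
qed

text \<open>
  The point is that the constant grows only polynomially in the parameter bound \<open>N\<close>, while the
  decay in the index is exponential.
\<close>

lemma homoclinic_combination:
  fixes N m r :: nat
  assumes w: "homoclinic p C \<rho> w" and \<rho>: "0 < \<rho>" "\<rho> < 1" and C: "C \<ge> 0" and m: "m \<le> N" "N \<ge> 1"
  shows "homoclinic p (real r * real N ^ r * (C / \<rho> ^ r)) \<rho> (\<lambda>j. \<Sum>i<r. real m ^ i * w (j + int i))"
proof -
  have summand: "real m ^ i * x \<le> real N ^ r * ((C / \<rho> ^ r) * \<rho> ^ n)"
    if i: "i < r" and x: "0 \<le> x" "x \<le> C * \<rho> ^ k" and k: "n \<le> k + r" for i k n :: nat and x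
  proof (rule mult_mono)
    have "real m ^ i \<le> real N ^ i" using m by (intro power_mono) auto
    also have "\<dots> \<le> real N ^ r" using m i by (intro power_increasing) auto
    finally show "real m ^ i \<le> real N ^ r" .
    have "\<rho> ^ (k + r) \<le> \<rho> ^ n" using \<rho> k by (intro power_decreasing) auto
    then have "\<rho> ^ k \<le> \<rho> ^ n / \<rho> ^ r" using \<rho> by (simp add: power_add field_simps)
    then have "C * \<rho> ^ k \<le> C * (\<rho> ^ n / \<rho> ^ r)" using C by (intro mult_left_mono)
    then show "x \<le> (C / \<rho> ^ r) * \<rho> ^ n" using x by simp
  qed (use x in auto)
  have sum_bound: "\<bar>\<Sum>i<r. real m ^ i * x i\<bar> \<le> real r * real N ^ r * (C / \<rho> ^ r) * \<rho> ^ n"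
    if x: "\<And>i. i < r \<Longrightarrow> \<exists>k. n \<le> k + r \<and> \<bar>x i\<bar> \<le> C * \<rho> ^ k" for x n
  proof -
    have "\<bar>\<Sum>i<r. real m ^ i * x i\<bar> \<le> (\<Sum>i<r. real m ^ i * \<bar>x i\<bar>)"
      by (rule order.trans[OF sum_abs]) (simp add: abs_mult)
    also have "\<dots> \<le> (\<Sum>i<r. real N ^ r * ((C / \<rho> ^ r) * \<rho> ^ n))"
    proof (rule sum_mono)
      fix i assume "i \<in> {..<r}"
      then obtain k where "i < r" "n \<le> k + r" "\<bar>x i\<bar> \<le> C * \<rho> ^ k" using x[of i] by auto
      then show "real m ^ i * \<bar>x i\<bar> \<le> real N ^ r * ((C / \<rho> ^ r) * \<rho> ^ n)" by (intro summand) auto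
    qed
    finally show ?thesis by simp
  qed
  show ?thesis
    unfolding homoclinic_def
  proof (intro conjI allI impI)
    show "recurrent p (\<lambda>j. \<Sum>i<r. real m ^ i * w (j + int i))"
      using w by (intro recurrent_sum recurrent_shift) (auto simp: homoclinic_def)
  next
    fix j :: int assume j: "j \<ge> 0"
    show "\<bar>\<Sum>i<r. real m ^ i * w (j + int i)\<bar> \<le> real r * real N ^ r * (C / \<rho> ^ r) * \<rho> ^ nat j"
    proof (rule sum_bound)
      fix i assume "i < r"
      show "\<exists>k. nat j \<le> k + r \<and> \<bar>w (j + int i)\<bar> \<le> C * \<rho> ^ k"
        using w j by (intro exI[of _ "nat (j + int i)"]) (auto simp: homoclinic_def)
    qed
  next
    fix j :: int
    obtain g where g: "\<And>l. g l \<in> \<int>" "\<And>l. \<bar>w l - g l\<bar> \<le> C * \<rho> ^ nat \<bar>l\<bar>"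
      using w unfolding homoclinic_def by metis
    have "\<bar>\<Sum>i<r. real m ^ i * (w (j + int i) - g (j + int i))\<bar>
        \<le> real r * real N ^ r * (C / \<rho> ^ r) * \<rho> ^ nat \<bar>j\<bar>"
    proof (rule sum_bound)
      fix i assume i: "i < r"
      show "\<exists>k. nat \<bar>j\<bar> \<le> k + r \<and> \<bar>w (j + int i) - g (j + int i)\<bar> \<le> C * \<rho> ^ k"
        using i g(2) by (intro exI[of _ "nat \<bar>j + int i\<bar>"]) auto
    qed
    then show "\<exists>g\<in>\<int>. \<bar>(\<Sum>i<r. real m ^ i * w (j + int i)) - g\<bar>
        \<le> real r * real N ^ r * (C / \<rho> ^ r) * \<rho> ^ nat \<bar>j\<bar>"
      using g(1) by (intro bexI[of _ "\<Sum>i<r. real m ^ i * g (j + int i)"])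
        (auto simp: right_diff_distrib sum_subtractf)
  qed
qed

text \<open>
  Start with any nonzero homoclinic \<open>w\<close> and consider the combinations with coefficients
  \<open>1, m, m\<^sup>2, \<dots>\<close> of \<open>r = degree p\<close> consecutive shifts, for \<open>m < N\<close>. A zero of the cosine at index
  \<open>j\<close> requires a rational value at distance \<open>1/4\<close> from the integers. The distance excludes
  \<open>|j| > J\<close> as soon as \<open>J\<close> is large and proportional to \<open>N\<close>, and for each remaining \<open>j\<close> fewer than
  \<open>r\<close> values of \<open>m\<close> give a rational value. So a good \<open>m\<close> exists when \<open>N\<close> exceeds \<open>(2 * J + 1) * r\<close>.
\<close>

lemma ex_homoclinic_cos_nonzero:
  assumes irr: "irreducible p" and monic: "lead_coeff p = 1" and const: "\<bar>coeff p 0\<bar> = 1"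
    and deg: "degree p > 0" and hyp: "\<And>z. z \<in> int_poly_roots p \<Longrightarrow> cmod z \<noteq> 1"
  shows "\<exists>y C \<rho>. 0 < \<rho> \<and> \<rho> < 1 \<and> C \<ge> 0 \<and> homoclinic p C \<rho> y \<and> (\<exists>j. y j \<noteq> 0) \<and>
           (\<forall>j. cos (2 * pi * y j) \<noteq> 0)"
proof -
  define r where "r = degree p"
  have r0: "r > 0" using deg by (simp add: r_def)
  obtain w C \<rho> j0 where \<rho>: "0 < \<rho>" "\<rho> < 1" and C: "C \<ge> 0" and w: "homoclinic p C \<rho> w" and nz: "w j0 \<noteq> 0"
    using ex_homoclinic[OF assms] by blast
  define B where "B = real r * (2 * real r) ^ r * (C / \<rho> ^ r)"
  have "(\<lambda>J. B * (real J + 1) ^ r * \<rho> ^ J) \<longlonglongrightarrow> 0" by (rule power_mult_power_tendsto_0[OF \<rho>])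
  then have "eventually (\<lambda>J. B * (real J + 1) ^ r * \<rho> ^ J < 1 / 4) sequentially"
    by (rule order_tendstoD) simp
  then obtain J where J: "B * (real J + 1) ^ r * \<rho> ^ J < 1 / 4"
    by (auto simp: eventually_sequentially)
  \<comment> \<open>large enough for the counting, and polynomial in \<open>J\<close>, so that the decay \<open>\<rho> ^ J\<close> still wins\<close>
  define N where "N = 2 * r * (J + 1)"
  define y where "y m j = (\<Sum>i<r. real m ^ i * w (j + int i))" for m j
  define bad where "bad j = {m\<in>{..<N}. y m j \<in> \<rat>}" for j
  have N1: "N \<ge> 1" using r0 by (simp add: N_def)
  have card_bad: "card (bad j) < r" for j
    unfolding bad_def y_def
    using homoclinic_window_irrational[OF w \<rho> monic const deg nz] by (intro card_rational_moments_less) (auto simp: r_def)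
  have "card (\<Union>j\<in>{- int J..int J}. bad j) \<le> (\<Sum>j\<in>{- int J..int J}. card (bad j))"
    by (rule card_UN_le) simp
  also have "\<dots> \<le> (\<Sum>j\<in>{- int J..int J}. r)" using card_bad by (intro sum_mono less_imp_le)
  also have "\<dots> = (2 * J + 1) * r" by (simp add: nat_add_distrib nat_mult_distrib)
  also have "\<dots> < N" using r0 by (simp add: N_def algebra_simps)
  finally have "card (\<Union>j\<in>{- int J..int J}. bad j) < card {..<N}" by simp
  then have "\<not> {..<N} \<subseteq> (\<Union>j\<in>{- int J..int J}. bad j)"
    using card_mono[of "\<Union>j\<in>{- int J..int J}. bad j" "{..<N}"] by (auto simp: bad_def)
  then obtain m where "m \<in> {..<N}" "m \<notin> (\<Union>j\<in>{- int J..int J}. bad j)" by blast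
  then have m: "m < N" "\<And>j. j \<in> {- int J..int J} \<Longrightarrow> y m j \<notin> \<rat>"
    unfolding bad_def by blast+
  define C' where "C' = real r * real N ^ r * (C / \<rho> ^ r)"
  have C'0: "C' \<ge> 0" using C \<rho> by (simp add: C'_def)
  have h: "homoclinic p C' \<rho> (y m)"
    unfolding C'_def y_def using m(1) N1 by (intro homoclinic_combination[OF w \<rho> C]) auto
  have C'J: "C' * \<rho> ^ J < 1 / 4"
  proof -
    have "real N = (2 * real r) * (real J + 1)" by (simp add: N_def algebra_simps)
    then have "real N ^ r = (2 * real r) ^ r * (real J + 1) ^ r" by (simp only: power_mult_distrib)
    then have "C' * \<rho> ^ J = B * (real J + 1) ^ r * \<rho> ^ J" by (simp only: C'_def B_def mult_ac)
    then show ?thesis using J by linarith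
  qed
  have "cos (2 * pi * y m j) \<noteq> 0" for j
  proof (cases "j \<in> {- int J..int J}")
    case True
    then show ?thesis using m(2) cos_two_pi_zero(1) by blast
  next
    case False
    obtain g where g: "g \<in> \<int>" "\<bar>y m j - g\<bar> \<le> C' * \<rho> ^ nat \<bar>j\<bar>"
      using h by (auto simp: homoclinic_def)
    have "C' * \<rho> ^ nat \<bar>j\<bar> \<le> C' * \<rho> ^ J"
      using False \<rho> C'0 by (intro mult_left_mono power_decreasing) auto
    then have "\<bar>y m j - g\<bar> < 1 / 4" using g C'J by linarith
    then show ?thesis using cos_two_pi_zero(2)[OF _ g(1)] by force
  qed
  moreover have "y m 0 \<noteq> 0" using m(2)[of 0] by auto
  ultimately show ?thesis using h \<rho> C'0 by blast
qed

section \<open>Fourier coefficients of a homoclinic solution\<close>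

lemma abs_cos_two_pi_ge:
  assumes "g \<in> \<int>"
  shows "1 - \<bar>cos (2 * pi * x)\<bar> \<le> 2 * pi * \<bar>x - g\<bar>"
proof -
  obtain k :: int where k: "g = of_int k" using assms by (auto elim: Ints_cases)
  define t where "t = 2 * pi * (x - g)"
  have "cos t = cos (2 * pi * x - of_int k * (2 * pi))" by (simp add: t_def k algebra_simps)
  also have "\<dots> = cos (2 * pi * x)"
    by (simp only: cos_diff mult.commute[of "of_int k"] sin_int_2pin cos_int_2pin mult_1_right mult_zero_right add_0_right)
  finally have eq: "cos t = cos (2 * pi * x)" .
  have "(sin (t / 2))\<^sup>2 \<le> \<bar>sin (t / 2)\<bar>"
    using mult_left_le[of "\<bar>sin (t/2)\<bar>" "\<bar>sin (t/2)\<bar>"] by (simp add: power2_eq_square)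
  also have "\<dots> \<le> \<bar>t / 2\<bar>" by (rule abs_sin_x_le_abs_x)
  finally have "2 * (sin (t / 2))\<^sup>2 \<le> \<bar>t\<bar>" by simp
  then have "cos t \<ge> 1 - \<bar>t\<bar>" using cos_double_sin[of "t / 2"] by simp
  then show ?thesis unfolding eq by (simp add: t_def abs_mult)
qed

text \<open>
  The nonnegative and the negative indices each contribute at most one geometric tail.
\<close>

lemma sum_power_abs_le:
  fixes \<rho> :: real and F :: "int set"
  assumes \<rho>: "0 < \<rho>" "\<rho> < 1" and F: "finite F" "\<And>j. j \<in> F \<Longrightarrow> \<bar>j\<bar> \<ge> int J"
  shows "(\<Sum>j\<in>F. \<rho> ^ nat \<bar>j\<bar>) \<le> 2 / (1 - \<rho>) * \<rho> ^ J"
proof -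
  have half: "(\<Sum>j\<in>G. \<rho> ^ nat \<bar>j\<bar>) \<le> \<rho> ^ J / (1 - \<rho>)"
    if G: "finite G" "\<And>j. j \<in> G \<Longrightarrow> \<bar>j\<bar> \<ge> int J" "inj_on abs G" for G :: "int set"
  proof -
    define f where "f j = nat \<bar>j\<bar> - J" for j :: int
    have "inj_on f G"
    proof (rule inj_onI)
      fix s t assume st: "s \<in> G" "t \<in> G" "f s = f t"
      then have "\<bar>s\<bar> = \<bar>t\<bar>" using G(2)[of s] G(2)[of t] unfolding f_def by linarith
      then show "s = t" using inj_onD[OF G(3)] st by blast
    qed
    have "(\<Sum>j\<in>G. \<rho> ^ nat \<bar>j\<bar>) = (\<Sum>j\<in>G. \<rho> ^ J * \<rho> ^ f j)"
      using G(2) by (intro sum.cong refl) (fastforce simp: f_def power_add[symmetric] nat_le_iff le_nat_iff)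
    also have "\<dots> = \<rho> ^ J * (\<Sum>k\<in>f ` G. \<rho> ^ k)"
      by (simp add: sum.reindex \<open>inj_on f G\<close> sum_distrib_left)
    also have "\<dots> \<le> \<rho> ^ J * (\<Sum>k. \<rho> ^ k)"
      using \<rho> G by (intro mult_left_mono sum_le_suminf summable_geometric) auto
    finally show ?thesis using \<rho> by (simp add: suminf_geometric)
  qed
  have "(\<Sum>j\<in>F. \<rho> ^ nat \<bar>j\<bar>) = (\<Sum>j\<in>{j\<in>F. j \<ge> 0}. \<rho> ^ nat \<bar>j\<bar>) + (\<Sum>j\<in>{j\<in>F. \<not> j \<ge> 0}. \<rho> ^ nat \<bar>j\<bar>)"
    using F(1) by (subst sum.union_disjoint[symmetric]) (auto intro!: sum.cong)
  also have "\<dots> \<le> \<rho> ^ J / (1 - \<rho>) + \<rho> ^ J / (1 - \<rho>)"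
    using F by (intro add_mono half) (auto simp: inj_on_def dest!: F(2))
  finally show ?thesis by simp
qed

text \<open>
  The deviations of \<open>|cos (2\<pi> y j)|\<close> from \<open>1\<close> are summable over \<open>\<int>\<close>, so the far factors contribute at
  least \<open>1/2\<close> and the finitely many near ones are nonzero.
\<close>

lemma homoclinic_cos_prod_lower_bound:
  assumes y: "homoclinic p C \<rho> y" and \<rho>: "0 < \<rho>" "\<rho> < 1" and C: "C \<ge> 0"
    and nz: "\<And>j. cos (2 * pi * y j) \<noteq> 0"
  shows "\<exists>c>0. \<forall>F. finite F \<longrightarrow> c \<le> (\<Prod>j\<in>F. \<bar>cos (2 * pi * y j)\<bar>)"
proof -
  define x where "x j = 1 - \<bar>cos (2 * pi * y j)\<bar>" for j
  have x01: "x j \<in> {0..1}" for j by (simp add: x_def)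
  have x_le: "x j \<le> 2 * pi * C * \<rho> ^ nat \<bar>j\<bar>" for j
  proof -
    obtain g where g: "g \<in> \<int>" "\<bar>y j - g\<bar> \<le> C * \<rho> ^ nat \<bar>j\<bar>"
      using y by (auto simp: homoclinic_def)
    have "x j \<le> 2 * pi * \<bar>y j - g\<bar>" unfolding x_def by (rule abs_cos_two_pi_ge[OF g(1)])
    also have "\<dots> \<le> 2 * pi * (C * \<rho> ^ nat \<bar>j\<bar>)" using g by (intro mult_left_mono) auto
    finally show ?thesis by simp
  qed
  obtain J where J: "2 * pi * C * (2 / (1 - \<rho>)) * \<rho> ^ J < 1 / 2"
    using ex_power_small[OF \<rho>, of "1/2" "2 * pi * C * (2 / (1 - \<rho>))"] by auto
  define A where "A = {- int J<..<int J}"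
  define c where "c = (\<Prod>j\<in>A. \<bar>cos (2 * pi * y j)\<bar>) / 2"
  show ?thesis
  proof (intro exI[of _ c] conjI allI impI)
    show "c > 0" unfolding c_def using nz by (auto intro!: prod_pos)
    fix F :: "int set" assume F: "finite F"
    have "sum x (F - A) \<le> (\<Sum>j\<in>F - A. 2 * pi * C * \<rho> ^ nat \<bar>j\<bar>)" by (intro sum_mono x_le)
    also have "\<dots> = 2 * pi * C * (\<Sum>j\<in>F - A. \<rho> ^ nat \<bar>j\<bar>)" by (simp add: sum_distrib_left)
    also have "\<dots> \<le> 2 * pi * C * (2 / (1 - \<rho>) * \<rho> ^ J)"
      using F C by (intro mult_left_mono sum_power_abs_le \<rho>) (auto simp: A_def)
    finally have "sum x (F - A) \<le> 1 / 2" using J by simp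
    then have tail: "1 / 2 \<le> (\<Prod>j\<in>F - A. \<bar>cos (2 * pi * y j)\<bar>)"
      using Weierstrass_prod_ineq[of "F - A" x] x01 by (simp add: x_def)
    have head: "(\<Prod>j\<in>A. \<bar>cos (2 * pi * y j)\<bar>) \<le> (\<Prod>j\<in>F \<inter> A. \<bar>cos (2 * pi * y j)\<bar>)"
    proof -
      have "(\<Prod>j\<in>A. \<bar>cos (2 * pi * y j)\<bar>)
          = (\<Prod>j\<in>A - F \<inter> A. \<bar>cos (2 * pi * y j)\<bar>) * (\<Prod>j\<in>F \<inter> A. \<bar>cos (2 * pi * y j)\<bar>)"
        by (intro prod.subset_diff) (auto simp: A_def)
      also have "\<dots> \<le> 1 * (\<Prod>j\<in>F \<inter> A. \<bar>cos (2 * pi * y j)\<bar>)"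
        by (intro mult_right_mono prod_le_1 prod_nonneg) auto
      finally show ?thesis by simp
    qed
    have "c = 1 / 2 * (\<Prod>j\<in>A. \<bar>cos (2 * pi * y j)\<bar>)" by (simp add: c_def)
    also have "\<dots> \<le> (\<Prod>j\<in>F - A. \<bar>cos (2 * pi * y j)\<bar>) * (\<Prod>j\<in>F \<inter> A. \<bar>cos (2 * pi * y j)\<bar>)"
      by (intro mult_mono tail head prod_nonneg) auto
    also have "\<dots> = (\<Prod>j\<in>F. \<bar>cos (2 * pi * y j)\<bar>)"
      using F by (subst prod.union_disjoint[symmetric]) (auto intro!: prod.cong)
    finally show "c \<le> (\<Prod>j\<in>F. \<bar>cos (2 * pi * y j)\<bar>)" .
  qed
qed

lemma cis_two_pi_inj:
  assumes "\<bar>a\<bar> < 1 / 2" "\<bar>b\<bar> < 1 / 2" "cis (2 * pi * a) = cis (2 * pi * b)"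
  shows "a = b"
proof -
  have "sin (2 * pi * a) = sin (2 * pi * b) \<and> cos (2 * pi * a) = cos (2 * pi * b)"
    using assms(3) by (simp add: complex_eq_iff)
  then obtain n :: int where "2 * pi * a = 2 * pi * b + 2 * pi * of_int n"
    by (subst (asm) sin_cos_eq_iff) auto
  then have "2 * pi * a = 2 * pi * (b + of_int n)" by (simp add: distrib_left)
  then have "a = b + of_int n" by simp
  moreover from this have "\<bar>real_of_int n\<bar> < 1" using assms(1,2) by linarith
  then have "n = 0" by linarith
  ultimately show ?thesis by simp
qed

text \<open>
  A nonzero homoclinic solution takes infinitely many values at nonnegative indices, and values of
  modulus below \<open>1/2\<close> are determined by their residue modulo \<open>1\<close>.
\<close>

lemma homoclinic_distinct_phases:
  assumes y: "homoclinic p C \<rho> y" and \<rho>: "0 < \<rho>" "\<rho> < 1" and monic: "lead_coeff p = 1" and const: "\<bar>coeff p 0\<bar> = 1"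
    and deg: "degree p > 0" and nz: "y k \<noteq> 0"
  shows "\<exists>I. finite I \<and> card I = K \<and> inj_on (\<lambda>s. cis (2 * pi * y s)) I"
proof -
  obtain J where J: "\<And>k. k \<ge> J \<Longrightarrow> C * \<rho> ^ k < 1 / 2" using ex_power_small[OF \<rho>, of "1/2" C] by auto
  have small: "\<bar>y j\<bar> < 1 / 2" if j: "j \<ge> int J" for j
  proof -
    have "\<bar>y j\<bar> \<le> C * \<rho> ^ nat j" using y j by (auto simp: homoclinic_def)
    also have "\<dots> < 1 / 2" using j by (intro J) linarith
    finally show ?thesis .
  qed
  have "infinite (y ` {0..})"
  proof
    assume fin: "finite (y ` {0..})"
    define e where "e = Min (insert 1 (abs ` (y ` {0..} - {0})))"
    have fin': "finite (insert 1 (abs ` (y ` {0..} - {0})))" using fin by auto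
    have "e > 0" unfolding e_def using fin' by (subst Min_gr_iff) auto
    moreover have "y j = 0" if "j \<ge> 0" "\<bar>y j\<bar> < e" for j
      using that Min_le[OF fin', of "\<bar>y j\<bar>"] unfolding e_def by force
    ultimately show False
      using homoclinic_eq_zero[OF y \<rho> monic const deg, of e] nz by blast
  qed
  moreover have "y ` {0..} = y ` {0..<int J} \<union> y ` {int J..}" 
    by (subst image_Un[symmetric], rule arg_cong[where f = "image y"]) auto
  ultimately have "infinite (y ` {int J..})" by auto
  then obtain Y where Y: "Y \<subseteq> y ` {int J..}" "finite Y" "card Y = K"
    using infinite_arbitrarily_large by blast
  obtain I where I: "I \<subseteq> {int J..}" "y ` I = Y" "inj_on y I"
    using subset_image_inj[of Y y "{int J..}"] Y(1) by auto
  show ?thesis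
  proof (intro exI[of _ I] conjI)
    show "finite I" using finite_imageD[of y I] I Y by auto
    show "card I = K" using card_image[OF I(3)] I(2) Y(3) by simp
    show "inj_on (\<lambda>s. cis (2 * pi * y s)) I"
    proof (rule inj_onI)
      fix s t assume st: "s \<in> I" "t \<in> I" and eq: "cis (2 * pi * y s) = cis (2 * pi * y t)"
      have "y s = y t" using st I(1) eq by (intro cis_two_pi_inj small) auto
      then show "s = t" using I(3) st by (auto dest: inj_onD)
    qed
  qed
qed

section \<open>Characters of sign sums\<close>

lemma int_span_0: "0 \<in> int_span lam"
  unfolding int_span_def by (intro range_eqI[of _ _ 0]) simp

lemma int_span_power: "lam ^ n \<in> int_span lam"
  unfolding int_span_def by (intro range_eqI[of _ _ "monom 1 n"]) (simp add: poly_monom)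

lemma int_span_add: "x \<in> int_span lam \<Longrightarrow> y \<in> int_span lam \<Longrightarrow> x + y \<in> int_span lam"
  unfolding int_span_def by (metis (no_types, lifting) of_int_poly_hom.hom_add poly_add rangeE rangeI)

lemma int_span_uminus: "x \<in> int_span lam \<Longrightarrow> - x \<in> int_span lam"
  unfolding int_span_def by (metis (no_types, lifting) of_int_poly_hom.hom_uminus poly_minus rangeE rangeI)

lemma int_span_of_nat_mult: "x \<in> int_span lam \<Longrightarrow> of_nat n * x \<in> int_span lam"
  by (induction n) (auto simp: distrib_right int_span_0 int_span_add)

locale additive_on_int_span =
  fixes lam :: complex and \<phi> :: "complex \<Rightarrow> real"
  assumes add: "\<And>x y. x \<in> int_span lam \<Longrightarrow> y \<in> int_span lam \<Longrightarrow> \<phi> (x + y) = \<phi> x + \<phi> y"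
begin

lemma zero: "\<phi> 0 = 0"
  using add[OF int_span_0 int_span_0] by simp

lemma uminus: "x \<in> int_span lam \<Longrightarrow> \<phi> (- x) = - \<phi> x"
  using add[of x "- x"] int_span_uminus zero by simp

lemma of_nat_mult: "x \<in> int_span lam \<Longrightarrow> \<phi> (of_nat n * x) = real n * \<phi> x"
  by (induction n) (auto simp: zero distrib_right add int_span_of_nat_mult)

end

lemma sign_sum_polynomials:
  assumes "x \<in> set_pmf (sign_sum_pmf lam n)"
  shows "\<exists>P. x = poly (of_int_poly P) lam \<and> (\<forall>i. \<bar>coeff P i\<bar> \<le> 1) \<and> (\<forall>i\<ge>n. coeff P i = 0)"
  using assms
proof (induction n arbitrary: x)
  case 0
  then show ?case by (intro exI[of _ 0]) (simp add: sign_sum_pmf_0)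
next
  case (Suc n)
  then obtain e s where es: "e \<in> {1, - 1}" "s \<in> set_pmf (sign_sum_pmf lam n)" "x = s + e * lam ^ n"
    by (auto simp: sign_sum_pmf_Suc set_pair_pmf)
  obtain P where P: "s = poly (of_int_poly P) lam" "\<And>i. \<bar>coeff P i\<bar> \<le> 1" "\<And>i. i \<ge> n \<Longrightarrow> coeff P i = 0"
    using Suc.IH[OF es(2)] by blast
  obtain d :: int where d: "e = of_int d" "\<bar>d\<bar> \<le> 1" using es(1) by (metis abs_1 abs_minus insertE of_int_1 of_int_minus order.refl singletonD)
  show ?case
    using P d es(3)
    by (intro exI[of _ "P + monom d n"])
       (auto simp: of_int_poly_hom.hom_add poly_monom)
qed

lemma set_sign_sum_pmf_subset_int_span: "set_pmf (sign_sum_pmf lam n) \<subseteq> int_span lam"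
  using sign_sum_polynomials unfolding int_span_def by blast

text \<open>
  The sine terms in the addition formula cancel on averaging over the last sign.
\<close>

lemma (in additive_on_int_span) expectation_cos_sign_sum:
  "measure_pmf.expectation (sign_sum_pmf lam n) (\<lambda>x. cos (2 * pi * \<phi> x))
     = (\<Prod>i<n. cos (2 * pi * \<phi> (lam ^ i)))"
proof (induction n)
  case 0
  show ?case by (simp add: sign_sum_pmf_0 zero)
next
  case (Suc n)
  let ?p = "sign_sum_pmf lam n" and ?S = "set_pmf (sign_sum_pmf lam n)"
  let ?f = "\<lambda>x. cos (2 * pi * \<phi> x)"
  have E: "measure_pmf.expectation ?p g = (\<Sum>x\<in>?S. g x * pmf ?p x)" for g :: "complex \<Rightarrow> real"
    by (rule integral_measure_pmf_real) (auto simp: finite_set_sign_sum_pmf)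
  have bind: "sign_sum_pmf lam (Suc n)
      = bind_pmf (pmf_of_set {1, -1}) (\<lambda>e. map_pmf (\<lambda>s. s + e * lam ^ n) ?p)"
    by (simp add: sign_sum_pmf_Suc map_pmf_def pair_pmf_def bind_assoc_pmf bind_return_pmf)
  have "measure_pmf.expectation (sign_sum_pmf lam (Suc n)) ?f
      = (\<Sum>e\<in>{1,-1}. pmf (pmf_of_set {1,-1}) e *\<^sub>R
           measure_pmf.expectation (map_pmf (\<lambda>s. s + e * lam ^ n) ?p) ?f)"
    unfolding bind by (rule pmf_expectation_bind) (auto simp: finite_set_sign_sum_pmf)
  also have "\<dots> = (measure_pmf.expectation ?p (\<lambda>x. ?f (x + lam ^ n))
      + measure_pmf.expectation ?p (\<lambda>x. ?f (x - lam ^ n))) / 2"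
    by simp
  also have "\<dots> = (\<Sum>x\<in>?S. (?f (x + lam ^ n) + ?f (x - lam ^ n)) / 2 * pmf ?p x)"
    unfolding E sum.distrib[symmetric] sum_divide_distrib by (intro sum.cong) (auto simp: field_simps)
  also have "\<dots> = (\<Sum>x\<in>?S. ?f x * pmf ?p x * cos (2 * pi * \<phi> (lam ^ n)))"
  proof (intro sum.cong refl)
    fix x assume "x \<in> ?S"
    then have x: "x \<in> int_span lam" using set_sign_sum_pmf_subset_int_span by blast
    have "\<phi> (x + lam ^ n) = \<phi> x + \<phi> (lam ^ n)" by (rule add[OF x int_span_power])
    moreover have "\<phi> (x - lam ^ n) = \<phi> x - \<phi> (lam ^ n)"
      using add[OF x int_span_uminus[OF int_span_power[of lam n]]] uminus[OF int_span_power] by simp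
    ultimately have "(?f (x + lam ^ n) + ?f (x - lam ^ n)) / 2 = ?f x * cos (2 * pi * \<phi> (lam ^ n))"
      by (simp add: distrib_left right_diff_distrib cos_add cos_diff)
    then show "(?f (x + lam ^ n) + ?f (x - lam ^ n)) / 2 * pmf ?p x = ?f x * pmf ?p x * cos (2 * pi * \<phi> (lam ^ n))"
      by simp
  qed
  also have "\<dots> = measure_pmf.expectation ?p ?f * cos (2 * pi * \<phi> (lam ^ n))"
    unfolding E by (rule sum_distrib_right[symmetric])
  finally show ?case by (simp add: Suc)
qed

section \<open>Rarity of large character sums\<close>

text \<open>
  Expanding the square, the diagonal contributes \<open>N\<close> times the number of characters at most; the
  off-diagonal geometric sums stay bounded as \<open>N\<close> grows, so a large \<open>N\<close> absorbs them.
\<close>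

lemma almost_orthogonality:
  fixes \<omega> :: "'i \<Rightarrow> complex"
  assumes fin: "finite I" and unit: "\<And>s. s \<in> I \<Longrightarrow> cmod (\<omega> s) = 1" and inj: "inj_on \<omega> I"
  shows "\<exists>N::nat>0. \<forall>b. (\<forall>s\<in>I. cmod (b s) \<le> 1) \<longrightarrow>
           (\<Sum>n<N. (cmod (\<Sum>s\<in>I. b s * \<omega> s ^ n))\<^sup>2) \<le> 2 * real N * real (card I)"
proof -
  define q where "q s t = \<omega> s * cnj (\<omega> t)" for s t
  have cq: "cmod (q s t) = 1" if "s \<in> I" "t \<in> I" for s t
    using unit that by (simp add: q_def norm_mult)
  have q1: "q s t \<noteq> 1" if "s \<in> I" "t \<in> I" "s \<noteq> t" for s t
  proof
    assume "q s t = 1"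
    then have "\<omega> s * (\<omega> t * cnj (\<omega> t)) = \<omega> t" by (simp add: q_def mult_ac)
    moreover have "\<omega> t * cnj (\<omega> t) = 1"
      using unit[OF that(2)] complex_norm_square[of "\<omega> t"] by simp
    ultimately show False using inj that by (auto dest: inj_onD)
  qed
  define h where "h s t = (if s = t then 0 else 2 / cmod (q s t - 1))" for s t
  define D where "D = (\<Sum>s\<in>I. \<Sum>t\<in>I. h s t)"
  obtain N0 :: nat where N0: "D < real N0" using reals_Archimedean2 by blast
  define N where "N = Suc N0"
  have inner: "cmod (\<Sum>n<N. q s t ^ n) \<le> (if s = t then real N else 0) + h s t"
    if st: "s \<in> I" "t \<in> I" for s t
  proof (cases "s = t")
    case True
    have "cmod (\<Sum>n<N. q s t ^ n) \<le> (\<Sum>n<N. 1)"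
      by (rule order.trans[OF norm_sum], rule sum_mono) (simp add: norm_power cq[OF st])
    then show ?thesis using True by (simp add: h_def)
  next
    case False
    have "(\<Sum>n<N. q s t ^ n) = (q s t ^ N - 1) / (q s t - 1)"
      by (rule geometric_sum[OF q1[OF st False]])
    moreover have "cmod (q s t ^ N - 1) \<le> 2"
      using norm_triangle_ineq4[of "q s t ^ N" 1] by (simp add: norm_power cq[OF st])
    ultimately show ?thesis using False by (simp add: h_def norm_divide divide_right_mono)
  qed
  show ?thesis
  proof (intro exI[of _ N] conjI allI impI)
    show "N > 0" by (simp add: N_def)
    fix b assume b: "\<forall>s\<in>I. cmod (b s) \<le> 1"
    have "complex_of_real (\<Sum>n<N. (cmod (\<Sum>s\<in>I. b s * \<omega> s ^ n))\<^sup>2)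
        = (\<Sum>n<N. (\<Sum>s\<in>I. b s * \<omega> s ^ n) * cnj (\<Sum>t\<in>I. b t * \<omega> t ^ n))"
      by (simp only: of_real_sum complex_norm_square)
    also have "\<dots> = (\<Sum>n<N. \<Sum>s\<in>I. \<Sum>t\<in>I. b s * cnj (b t) * q s t ^ n)"
      unfolding cnj_sum sum_product by (simp add: q_def power_mult_distrib mult_ac)
    also have "\<dots> = (\<Sum>s\<in>I. \<Sum>n<N. \<Sum>t\<in>I. b s * cnj (b t) * q s t ^ n)"
      by (rule sum.swap)
    also have "\<dots> = (\<Sum>s\<in>I. \<Sum>t\<in>I. \<Sum>n<N. b s * cnj (b t) * q s t ^ n)"
      by (intro sum.cong refl sum.swap)
    also have "\<dots> = (\<Sum>s\<in>I. \<Sum>t\<in>I. b s * cnj (b t) * (\<Sum>n<N. q s t ^ n))"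
      by (simp only: sum_distrib_left)
    finally have eq: "complex_of_real (\<Sum>n<N. (cmod (\<Sum>s\<in>I. b s * \<omega> s ^ n))\<^sup>2)
        = (\<Sum>s\<in>I. \<Sum>t\<in>I. b s * cnj (b t) * (\<Sum>n<N. q s t ^ n))" .
    have "(\<Sum>n<N. (cmod (\<Sum>s\<in>I. b s * \<omega> s ^ n))\<^sup>2)
        \<le> cmod (complex_of_real (\<Sum>n<N. (cmod (\<Sum>s\<in>I. b s * \<omega> s ^ n))\<^sup>2))"
      by (simp only: norm_of_real abs_ge_self)
    also have "\<dots> \<le> (\<Sum>s\<in>I. \<Sum>t\<in>I. cmod (b s * cnj (b t) * (\<Sum>n<N. q s t ^ n)))"
      unfolding eq by (rule order.trans[OF norm_sum], rule sum_mono, rule norm_sum)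
    also have "\<dots> \<le> (\<Sum>s\<in>I. \<Sum>t\<in>I. (if s = t then real N else 0) + h s t)"
    proof (intro sum_mono)
      fix s t assume st: "s \<in> I" "t \<in> I"
      have "cmod (b s * cnj (b t)) \<le> 1" using b st by (simp add: norm_mult mult_le_one)
      then have "cmod (b s * cnj (b t) * (\<Sum>n<N. q s t ^ n)) \<le> 1 * cmod (\<Sum>n<N. q s t ^ n)"
        unfolding norm_mult[of "b s * cnj (b t)"] by (intro mult_right_mono) auto
      then show "cmod (b s * cnj (b t) * (\<Sum>n<N. q s t ^ n)) \<le> (if s = t then real N else 0) + h s t"
        using inner[OF st] by simp
    qed
    also have "\<dots> = real N * real (card I) + D"
      using fin by (simp add: sum.distrib D_def mult.commute)
    also have "D \<le> real N * real (card I)"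
    proof (cases "I = {}")
      case False
      then have "1 \<le> real (card I)" using fin by (simp add: Suc_leI card_gt_0_iff)
      then have "real N * 1 \<le> real N * real (card I)" by (intro mult_left_mono) auto
      moreover have "D \<le> real N" using N0 by (simp add: N_def)
      ultimately show ?thesis by linarith
    qed (simp add: D_def)
    finally show "(\<Sum>n<N. (cmod (\<Sum>s\<in>I. b s * \<omega> s ^ n))\<^sup>2) \<le> 2 * real N * real (card I)" by simp
  qed
qed

lemma geometric_sum_le:
  fixes a :: real
  assumes "a \<ge> 0" "a \<noteq> 1"
  shows "(\<Sum>i<n. a ^ i) \<le> max 1 a ^ n / \<bar>a - 1\<bar>"
proof (cases "a < 1")
  case True
  have "(\<Sum>i<n. a ^ i) = (1 - a ^ n) / (1 - a)"
    using geometric_sum[OF assms(2), of n] True by (simp add: divide_simps) argo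
  also have "\<dots> \<le> 1 / (1 - a)" using True assms by (intro divide_right_mono) auto
  finally show ?thesis using True by simp
next
  case False
  have "(\<Sum>i<n. a ^ i) = (a ^ n - 1) / (a - 1)" by (rule geometric_sum[OF assms(2)])
  also have "\<dots> \<le> a ^ n / (a - 1)" using False by (intro divide_right_mono) auto
  finally show ?thesis using False by simp
qed

text \<open>
  At contracting roots \<open>z ^ k\<close> tends to \<open>0\<close>; at expanding ones it is negligible against \<open>z ^ (2 * k)\<close>. Thus
  translation by multiples of \<open>\<lambda> ^ k\<close> does not leave a box of length \<open>2 * k\<close>, up to constants that do not
  depend on the number \<open>N\<close> of multiples.
\<close>

lemma ex_shift_bound:
  fixes R :: "complex set"
  assumes "finite R" "\<And>z. z \<in> R \<Longrightarrow> cmod z \<noteq> 1"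
  shows "\<exists>k\<ge>1. \<forall>z\<in>R. real N * cmod z ^ k \<le> max 1 (cmod z) ^ (2 * k)"
proof -
  have "eventually (\<lambda>k. real N * cmod z ^ k \<le> max 1 (cmod z) ^ (2 * k)) sequentially"
    if z: "z \<in> R" for z
  proof (cases "cmod z < 1")
    case True
    have "(\<lambda>k. real N * cmod z ^ k) \<longlonglongrightarrow> real N * 0"
      using True by (intro tendsto_intros LIMSEQ_power_zero) auto
    then have "eventually (\<lambda>k. real N * cmod z ^ k < 1) sequentially"
      by (intro order_tendstoD(2)[where y = "real N * 0"]) auto
    then show ?thesis using True by (auto elim!: eventually_mono)
  next
    case False
    then have z1: "cmod z > 1" using assms(2)[OF z] by simp
    obtain k0 where "real N < cmod z ^ k0" using real_arch_pow[OF z1] by blast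
    then have "real N \<le> cmod z ^ k" if "k \<ge> k0" for k
      using power_increasing[OF that less_imp_le[OF z1]] by linarith
    then have "eventually (\<lambda>k. real N \<le> cmod z ^ k) sequentially"
      by (auto simp: eventually_sequentially)
    then show ?thesis
    proof eventually_elim
      case (elim k)
      have "real N * cmod z ^ k \<le> cmod z ^ k * cmod z ^ k" using elim by (intro mult_right_mono) auto
      then show ?case using z1 by (simp add: mult_2 power_add)
    qed
  qed
  then have "eventually (\<lambda>k. \<forall>z\<in>R. real N * cmod z ^ k \<le> max 1 (cmod z) ^ (2 * k)) sequentially"
    using assms(1) by (intro eventually_ball_finite) auto
  then have "eventually (\<lambda>k. k \<ge> 1 \<and> (\<forall>z\<in>R. real N * cmod z ^ k \<le> max 1 (cmod z) ^ (2 * k))) sequentially"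
    using eventually_ge_at_top[of 1] by eventually_elim auto
  then show ?thesis by (auto simp: eventually_sequentially)
qed

lemma sign_sum_shift_in_conjugate_box:
  assumes x: "x \<in> set_pmf (sign_sum_pmf lam n)" and hyp: "\<And>z. z \<in> int_poly_roots p \<Longrightarrow> cmod z \<noteq> 1"
    and C: "\<And>z. z \<in> int_poly_roots p \<Longrightarrow> 1 / \<bar>cmod z - 1\<bar> + 1 \<le> C"
    and m: "\<And>z. z \<in> int_poly_roots p \<Longrightarrow> real m * cmod z ^ k \<le> max 1 (cmod z) ^ n"
  shows "x - of_nat m * lam ^ k \<in> conjugate_box p lam C n"
proof -
  obtain P where P: "x = poly (of_int_poly P) lam" "\<And>i. \<bar>coeff P i\<bar> \<le> 1" "\<And>i. i \<ge> n \<Longrightarrow> coeff P i = 0"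
    using sign_sum_polynomials[OF x] by blast
  define Q where "Q = P - monom (int m) k"
  have Q: "poly (of_int_poly Q) z = poly (of_int_poly P) z - of_nat m * z ^ k" for z :: complex
    by (simp add: Q_def of_int_poly_hom.hom_minus poly_monom)
  have "cmod (poly (of_int_poly Q) z) \<le> C * max 1 (cmod z) ^ n" if z: "z \<in> int_poly_roots p" for z
  proof -
    have "poly (of_int_poly P) z = (\<Sum>i<n. of_int (coeff P i) * z ^ i)"
    proof -
      have "poly (of_int_poly P) z = (\<Sum>i\<le>max n (degree P). of_int (coeff P i) * z ^ i)"
        unfolding poly_altdef by (intro sum.mono_neutral_cong_left) (auto simp: coeff_eq_0)
      also have "\<dots> = (\<Sum>i<n. of_int (coeff P i) * z ^ i)"
        by (rule sum.mono_neutral_right) (auto simp: P(3))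
      finally show ?thesis .
    qed
    then have "cmod (poly (of_int_poly P) z) \<le> (\<Sum>i<n. cmod (of_int (coeff P i)) * cmod z ^ i)"
      by (simp only: norm_mult[symmetric] norm_power[symmetric]) (rule norm_sum)
    also have "\<dots> \<le> (\<Sum>i<n. 1 * cmod z ^ i)"
      using P(2) by (intro sum_mono mult_right_mono) (auto simp flip: of_int_abs)
    also have "\<dots> \<le> max 1 (cmod z) ^ n / \<bar>cmod z - 1\<bar>"
      using geometric_sum_le[of "cmod z" n] hyp[OF z] by simp
    finally have "cmod (poly (of_int_poly Q) z) \<le> max 1 (cmod z) ^ n / \<bar>cmod z - 1\<bar> + real m * cmod z ^ k"
      unfolding Q using norm_triangle_ineq4[of "poly (of_int_poly P) z" "of_nat m * z ^ k"]
      by (simp add: norm_mult norm_power)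
    also have "\<dots> \<le> (1 / \<bar>cmod z - 1\<bar> + 1) * max 1 (cmod z) ^ n"
      using m[OF z] by (simp add: distrib_right)
    also have "\<dots> \<le> C * max 1 (cmod z) ^ n" by (intro mult_right_mono C[OF z]) auto
    finally show ?thesis .
  qed
  then show ?thesis unfolding conjugate_box_def P(1) Q[symmetric] by blast
qed

text \<open>
  A second moment bound. For each \<open>n < N\<close> the sum of \<open>|Z|\<^sup>2\<close> over \<open>S\<close> is at most the sum over \<open>B\<close> of its
  translate by \<open>n * lam ^ k\<close>. Averaging over \<open>n\<close>, the characters at a fixed base point rotate with
  distinct phases \<open>y s\<close>, so almost orthogonality leaves only the diagonal.
\<close>

lemma large_values_of_character_sum:
  fixes B :: "complex set"
  assumes I: "finite I" "I \<noteq> {}" and add: "\<And>s. s \<in> I \<Longrightarrow> additive_on_int_span lam (\<phi> s)"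
    and \<phi>: "\<And>s. s \<in> I \<Longrightarrow> \<phi> s (lam ^ k) = y s"
    and \<sigma>: "\<And>s. s \<in> I \<Longrightarrow> cmod (\<sigma> s) \<le> 1"
    and N: "N > 0" "\<And>b. \<forall>s\<in>I. cmod (b s) \<le> 1 \<Longrightarrow>
       (\<Sum>n<N. (cmod (\<Sum>s\<in>I. b s * cis (2 * pi * y s) ^ n))\<^sup>2) \<le> 2 * real N * real (card I)"
    and S: "finite S" "S \<subseteq> int_span lam" and B: "finite B"
    and shift: "\<And>x n. x \<in> S \<Longrightarrow> n < N \<Longrightarrow> x - of_nat n * lam ^ k \<in> B"
    and c: "c > 0"
  shows "real (card {x\<in>S. c * real (card I) \<le> cmod (\<Sum>s\<in>I. \<sigma> s * cis (2 * pi * \<phi> s x))})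
           \<le> 2 / (c\<^sup>2 * real (card I)) * real (card B)"
proof -
  define Z where "Z x = (\<Sum>s\<in>I. \<sigma> s * cis (2 * pi * \<phi> s x))" for x
  define T where "T = {x\<in>S. c * real (card I) \<le> cmod (Z x)}"
  define B' where "B' = B \<inter> int_span lam"
  have card_I: "real (card I) > 0" using I by (simp add: card_gt_0_iff)
  have lam_n: "of_nat n * lam ^ k \<in> int_span lam" for n
    by (intro int_span_of_nat_mult int_span_power)
  have Z_shift: "Z (x + of_nat n * lam ^ k) = (\<Sum>s\<in>I. \<sigma> s * cis (2 * pi * \<phi> s x) * cis (2 * pi * y s) ^ n)"
    if x: "x \<in> int_span lam" for x n
    unfolding Z_def
  proof (intro sum.cong refl)
    fix s assume s: "s \<in> I"
    interpret additive_on_int_span lam "\<phi> s" by (rule add[OF s])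
    have "\<phi> s (x + of_nat n * lam ^ k) = \<phi> s x + real n * y s"
      using \<phi>[OF s] by (simp add: local.add x lam_n of_nat_mult int_span_power)
    then show "\<sigma> s * cis (2 * pi * \<phi> s (x + of_nat n * lam ^ k)) = \<sigma> s * cis (2 * pi * \<phi> s x) * cis (2 * pi * y s) ^ n"
      by (simp add: distrib_left cis_mult[symmetric] Complex.DeMoivre mult_ac)
  qed
  have one_shift: "(\<Sum>x\<in>S. (cmod (Z x))\<^sup>2) \<le> (\<Sum>x\<in>B'. (cmod (Z (x + of_nat n * lam ^ k)))\<^sup>2)" if n: "n < N" for n
  proof -
    let ?g = "\<lambda>x. x - of_nat n * lam ^ k"
    have "(\<Sum>x\<in>S. (cmod (Z x))\<^sup>2) = (\<Sum>x\<in>?g ` S. (cmod (Z (x + of_nat n * lam ^ k)))\<^sup>2)"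
      by (subst sum.reindex) (auto intro: inj_onI)
    also have "\<dots> \<le> (\<Sum>x\<in>B'. (cmod (Z (x + of_nat n * lam ^ k)))\<^sup>2)"
    proof (rule sum_mono2)
      show "?g ` S \<subseteq> B'"
        using shift[OF _ n] S(2) int_span_add[OF _ int_span_uminus[OF lam_n[of n]]]
        by (auto simp: B'_def)
    qed (use B in \<open>auto simp: B'_def\<close>)
    finally show ?thesis .
  qed
  have "real N * (\<Sum>x\<in>S. (cmod (Z x))\<^sup>2) = (\<Sum>n<N. \<Sum>x\<in>S. (cmod (Z x))\<^sup>2)" by simp
  also have "\<dots> \<le> (\<Sum>n<N. \<Sum>x\<in>B'. (cmod (Z (x + of_nat n * lam ^ k)))\<^sup>2)"
    by (intro sum_mono one_shift) simp
  also have "\<dots> = (\<Sum>x\<in>B'. \<Sum>n<N. (cmod (Z (x + of_nat n * lam ^ k)))\<^sup>2)" by (rule sum.swap)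
  also have "\<dots> \<le> (\<Sum>x\<in>B'. 2 * real N * real (card I))"
  proof (rule sum_mono)
    fix x assume "x \<in> B'"
    then have x: "x \<in> int_span lam" by (simp add: B'_def)
    show "(\<Sum>n<N. (cmod (Z (x + of_nat n * lam ^ k)))\<^sup>2) \<le> 2 * real N * real (card I)"
      unfolding Z_shift[OF x] by (rule N(2)) (use \<sigma> in \<open>auto simp: norm_mult\<close>)
  qed
  also have "\<dots> = real (card B') * (2 * real N * real (card I))" by simp
  also have "\<dots> \<le> real (card B) * (2 * real N * real (card I))"
    using B by (intro mult_right_mono) (auto simp: B'_def intro!: card_mono)
  finally have total: "(\<Sum>x\<in>S. (cmod (Z x))\<^sup>2) \<le> 2 * real (card I) * real (card B)"
    using N(1) by (simp add: field_simps)
  have "real (card T) * (c * real (card I))\<^sup>2 = (\<Sum>x\<in>T. (c * real (card I))\<^sup>2)" by simp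
  also have "\<dots> \<le> (\<Sum>x\<in>T. (cmod (Z x))\<^sup>2)"
    using c by (intro sum_mono power_mono) (auto simp: T_def)
  also have "\<dots> \<le> (\<Sum>x\<in>S. (cmod (Z x))\<^sup>2)" using S(1) by (intro sum_mono2) (auto simp: T_def)
  also note total
  finally have "real (card T) \<le> 2 * real (card I) * real (card B) / (c * real (card I))\<^sup>2"
    using c card_I by (simp add: pos_le_divide_eq)
  also have "\<dots> = 2 / (c\<^sup>2 * real (card I)) * real (card B)"
    using c card_I by (simp add: power2_eq_square field_simps)
  finally show ?thesis unfolding T_def Z_def .
qed

lemma expectation_lower_bound_imp_measure:
  fixes f :: "'a \<Rightarrow> real"
  assumes fin: "finite (set_pmf p)" and f: "\<And>x. x \<in> set_pmf p \<Longrightarrow> f x \<le> g x" "\<And>x. x \<in> set_pmf p \<Longrightarrow> g x \<le> K"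
    and K: "K > 0" and c: "c \<ge> 0" and E: "measure_pmf.expectation p f \<ge> 2 * c * K"
  shows "measure (measure_pmf p) {x\<in>set_pmf p. c * K \<le> g x} \<ge> c"
proof -
  let ?T = "{x\<in>set_pmf p. c * K \<le> g x}"
  have "2 * c * K \<le> (\<Sum>x\<in>set_pmf p. f x * pmf p x)"
    using E by (subst (asm) integral_measure_pmf_real[of "set_pmf p"]) (auto simp: fin)
  also have "\<dots> \<le> (\<Sum>x\<in>set_pmf p. (if x \<in> ?T then pmf p x * K else 0) + pmf p x * (c * K))"
  proof (rule sum_mono)
    fix x assume x: "x \<in> set_pmf p"
    show "f x * pmf p x \<le> (if x \<in> ?T then pmf p x * K else 0) + pmf p x * (c * K)"
    proof (cases "x \<in> ?T")
      case True
      have "f x * pmf p x \<le> K * pmf p x" using f[OF x] by (intro mult_right_mono) auto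
      then show ?thesis using True c K by (simp add: mult.commute add_increasing2)
    next
      case False
      then have "f x \<le> c * K" using f(1)[OF x] x by auto
      then have "f x * pmf p x \<le> (c * K) * pmf p x" by (intro mult_right_mono) auto
      then show ?thesis
        by (simp only: if_not_P[OF False] add_0_left mult.commute[of "pmf p x"])
    qed
  qed
  also have "\<dots> = (\<Sum>x\<in>?T. pmf p x) * K + c * K"
    using fin by (simp add: sum.distrib sum.inter_filter[symmetric] sum_distrib_right[symmetric] sum_pmf_eq_1)
  also have "(\<Sum>x\<in>?T. pmf p x) = measure (measure_pmf p) ?T"
    using fin by (simp add: measure_measure_pmf_finite)
  finally have "c * K \<le> measure (measure_pmf p) ?T * K" by (simp add: mult.commute)
  then show ?thesis using K by simp
qed

text \<open>
  The constants \<open>c\<close> and \<open>D\<close> do not depend on the number \<open>K\<close> of characters used, whereas the set that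
  carries the mass \<open>c\<close> shrinks by the factor \<open>K\<close>.
\<close>

lemma concentration_of_sign_sums:
  assumes irr: "irreducible p" and monic: "lead_coeff p = 1" and const: "\<bar>coeff p 0\<bar> = 1"
    and hyp: "\<And>z. z \<in> int_poly_roots p \<Longrightarrow> cmod z \<noteq> 1" and lam: "lam \<in> int_poly_roots p"
  defines "M \<equiv> (\<Prod>z\<in>int_poly_roots p. max 1 (cmod z))"
  shows "\<exists>c>0. \<exists>D>0. \<forall>K\<ge>1. \<exists>n\<ge>1. \<exists>T\<subseteq>set_pmf (sign_sum_pmf lam n).
           measure (measure_pmf (sign_sum_pmf lam n)) T \<ge> c \<and>
           real (card (set_pmf (sign_sum_pmf lam n))) \<le> D * M ^ n \<and>
           real (card T) \<le> 2 / (c\<^sup>2 * real K) * (D * M ^ n)"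
proof -
  let ?R = "int_poly_roots p"
  have fin: "finite ?R" using irr by (intro finite_int_poly_roots) auto
  have deg: "degree p > 0"
    using lam fin card_int_poly_roots[OF irr] by (metis card_gt_0_iff empty_iff)
  obtain y C \<rho> j0 where \<rho>: "0 < \<rho>" "\<rho> < 1" and C: "C \<ge> 0" and y: "homoclinic p C \<rho> y"
    and nz: "y j0 \<noteq> 0" and cos_nz: "\<And>j. cos (2 * pi * y j) \<noteq> 0"
    using ex_homoclinic_cos_nonzero[OF irr monic const deg hyp] by blast
  obtain c0 where c0: "c0 > 0" "\<And>F. finite F \<Longrightarrow> c0 \<le> (\<Prod>j\<in>F. \<bar>cos (2 * pi * y j)\<bar>)"
    using homoclinic_cos_prod_lower_bound[OF y \<rho> C cos_nz] by blast
  define c where "c = c0 / 2"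
  have c: "c > 0" using c0 by (simp add: c_def)
  \<comment> \<open>the additional \<open>1\<close> leaves room for the translations\<close>
  define C1 where "C1 = (\<Sum>z\<in>?R. 1 / \<bar>cmod z - 1\<bar>) + 1"
  have C1_ge: "1 / \<bar>cmod z - 1\<bar> + 1 \<le> C1" if "z \<in> ?R" for z
    using member_le_sum[OF that, of "\<lambda>z. 1 / \<bar>cmod z - 1\<bar>"] fin by (simp add: C1_def)
  have C1: "C1 \<ge> 0" unfolding C1_def by (intro add_nonneg_nonneg sum_nonneg) auto
  obtain D where D: "D > 0" "\<And>n. finite (conjugate_box p lam C1 n)"
    "\<And>n. real (card (conjugate_box p lam C1 n)) \<le> D * M ^ n"
    using card_conjugate_box[OF irr monic lam C1] unfolding M_def by blast
  show ?thesis
  proof (rule exI[of _ c], intro conjI c, rule exI[of _ D], intro conjI allI impI D(1))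
    fix K :: nat assume K: "K \<ge> 1"
    obtain I where I: "finite I" "card I = K" "inj_on (\<lambda>s. cis (2 * pi * y s)) I"
      using homoclinic_distinct_phases[OF y \<rho> monic const deg nz] by blast
    have I0: "I \<noteq> {}" using I K by auto
    obtain N :: nat where N: "N > 0" "\<And>b. \<forall>s\<in>I. cmod (b s) \<le> 1 \<Longrightarrow>
       (\<Sum>n<N. (cmod (\<Sum>s\<in>I. b s * cis (2 * pi * y s) ^ n))\<^sup>2) \<le> 2 * real N * real (card I)"
      using almost_orthogonality[OF I(1) _ I(3)] by auto
    obtain k where k: "k \<ge> 1" "\<And>z. z \<in> ?R \<Longrightarrow> real N * cmod z ^ k \<le> max 1 (cmod z) ^ (2 * k)"
      using ex_shift_bound[OF fin hyp, of N] by blast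
    \<comment> \<open>the middle power \<open>lam ^ k\<close> is small against the box, and character \<open>s\<close> will take the phase \<open>y s\<close> on it\<close>
    define n where "n = 2 * k"
    let ?p = "sign_sum_pmf lam n" and ?S = "set_pmf (sign_sum_pmf lam n)"
    have "recurrent p (\<lambda>j. y (j + (s - int k)))" for s
      using y by (intro recurrent_shift) (simp add: homoclinic_def)
    then have "\<exists>\<phi>. (\<forall>x\<in>int_span lam. \<forall>x'\<in>int_span lam. \<phi> (x + x') = \<phi> x + \<phi> x') \<and>
           (\<forall>i. \<phi> (lam ^ i) = y (int i + (s - int k)))" for s
      by (rule ex_additive_extension[OF irr lam])
    then obtain \<phi> where \<phi>: "\<And>s. additive_on_int_span lam (\<phi> s)"
        "\<And>s i. \<phi> s (lam ^ i) = y (int i + (s - int k))"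
      unfolding additive_on_int_span_def by metis
    \<comment> \<open>the signs make all the real expectations add up\<close>
    define \<sigma> where "\<sigma> s = sgn (\<Prod>i<n. cos (2 * pi * \<phi> s (lam ^ i)))" for s
    define Z where "Z x = (\<Sum>s\<in>I. complex_of_real (\<sigma> s) * cis (2 * pi * \<phi> s x))" for x
    define T where "T = {x\<in>?S. c * real K \<le> cmod (Z x)}"
    have \<sigma>: "\<bar>\<sigma> s\<bar> \<le> 1" for s by (simp add: \<sigma>_def abs_sgn_eq)
    have shift: "x - of_nat m * lam ^ k \<in> conjugate_box p lam C1 n" if "x \<in> ?S" "m < N" for x m
    proof (rule sign_sum_shift_in_conjugate_box[OF that(1) hyp C1_ge])
      fix z assume z: "z \<in> ?R"
      have "real m * cmod z ^ k \<le> real N * cmod z ^ k" using that by (intro mult_right_mono) auto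
      then show "real m * cmod z ^ k \<le> max 1 (cmod z) ^ n" using k(2)[OF z] by (simp add: n_def)
    qed
    have "?S \<subseteq> conjugate_box p lam C1 n" using shift[of _ 0] N(1) by auto
    then have "card ?S \<le> card (conjugate_box p lam C1 n)" by (intro card_mono D)
    then have card_S: "real (card ?S) \<le> D * M ^ n" using D(3)[of n] by linarith
    have "real (card T) \<le> 2 / (c\<^sup>2 * real (card I)) * real (card (conjugate_box p lam C1 n))"
      unfolding T_def Z_def I(2)[symmetric]
      by (rule large_values_of_character_sum[OF I(1) I0 \<phi>(1) _ _ N finite_set_sign_sum_pmf
            set_sign_sum_pmf_subset_int_span D(2) shift c])
         (use \<sigma> in \<open>auto simp: \<phi>(2)\<close>)
    also have "\<dots> \<le> 2 / (c\<^sup>2 * real K) * (D * M ^ n)"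
      unfolding I(2) using D(3) by (intro mult_left_mono) auto
    finally have card_T: "real (card T) \<le> 2 / (c\<^sup>2 * real K) * (D * M ^ n)" .
    have "measure (measure_pmf ?p) T \<ge> c"
      unfolding T_def
    proof (rule expectation_lower_bound_imp_measure[where f = "\<lambda>x. Re (Z x)"])
      show "cmod (Z x) \<le> real K" for x
      proof -
        have "cmod (Z x) \<le> (\<Sum>s\<in>I. 1)"
          unfolding Z_def by (rule order.trans[OF norm_sum], rule sum_mono) (use \<sigma> in \<open>simp add: norm_mult\<close>)
        then show ?thesis using I by simp
      qed
      have "measure_pmf.expectation ?p (\<lambda>x. Re (Z x))
          = (\<Sum>s\<in>I. \<sigma> s * measure_pmf.expectation ?p (\<lambda>x. cos (2 * pi * \<phi> s x)))"
        unfolding Z_def by (simp add: integrable_measure_pmf_finite finite_set_sign_sum_pmf)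
      also have "\<dots> = (\<Sum>s\<in>I. \<bar>\<Prod>i<n. cos (2 * pi * \<phi> s (lam ^ i))\<bar>)"
        unfolding additive_on_int_span.expectation_cos_sign_sum[OF \<phi>(1)] \<sigma>_def
        by (simp add: abs_sgn mult.commute)
      also have "\<dots> \<ge> (\<Sum>s\<in>I. c0)"
      proof (rule sum_mono)
        fix s assume "s \<in> I"
        have "c0 \<le> (\<Prod>j\<in>(\<lambda>i. int i + (s - int k)) ` {..<n}. \<bar>cos (2 * pi * y j)\<bar>)"
          by (intro c0) simp
        also have "\<dots> = \<bar>\<Prod>i<n. cos (2 * pi * \<phi> s (lam ^ i))\<bar>"
          by (subst prod.reindex) (auto intro: inj_onI simp: \<phi>(2) abs_prod)
        finally show "c0 \<le> \<bar>\<Prod>i<n. cos (2 * pi * \<phi> s (lam ^ i))\<bar>" .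
      qed
      finally show "measure_pmf.expectation ?p (\<lambda>x. Re (Z x)) \<ge> 2 * c * real K"
        using I by (simp add: c_def mult.commute)
    qed (use K c in \<open>auto simp: finite_set_sign_sum_pmf complex_Re_le_cmod\<close>)
    then show "\<exists>n\<ge>1. \<exists>T\<subseteq>set_pmf (sign_sum_pmf lam n).
           measure (measure_pmf (sign_sum_pmf lam n)) T \<ge> c \<and>
           real (card (set_pmf (sign_sum_pmf lam n))) \<le> D * M ^ n \<and>
           real (card T) \<le> 2 / (c\<^sup>2 * real K) * (D * M ^ n)"
      using card_S card_T k(1) by (intro exI[of _ n] exI[of _ T] conjI) (auto simp: n_def T_def)
  qed
qed

section \<open>Entropy of sign sums of a hyperbolic unit\<close>

theorem proposition7:
  fixes lam :: complex
  assumes "lam \<noteq> 0"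
    and "algebraic lam"
    and "mahler_measure_of lam < 2"
    and "\<forall>z \<in> galois_conjugates lam. cmod z \<noteq> 1"
  shows "entropy_rate lam < log 2 (mahler_measure_of lam)"
proof -
  define p where "p = min_int_poly lam"
  have p: "irreducible p" "lead_coeff p > 0" "poly (of_int_poly p) lam = 0"
    using theI'[OF min_int_poly_ex1[OF assms(2)]] by (auto simp: p_def min_int_poly_def)
  have mm: "mahler_measure p < 2" using assms(3) by (simp add: mahler_measure_of_def p_def)
  have unit: "lead_coeff p = 1" "\<bar>coeff p 0\<bar> = 1"
    using irreducible_int_poly_unit[OF p(1,2) mm p(3) assms(1)] by auto
  have roots: "int_poly_roots p = galois_conjugates lam"
    by (simp add: int_poly_roots_def galois_conjugates_def p_def)
  have hyp: "\<And>z. z \<in> int_poly_roots p \<Longrightarrow> cmod z \<noteq> 1" using assms(4) roots by blast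
  have lam: "lam \<in> int_poly_roots p" using p(3) by (simp add: int_poly_roots_def)
  define M where "M = (\<Prod>z\<in>int_poly_roots p. max 1 (cmod z))"
  have M: "mahler_measure_of lam = M"
    using mahler_measure_irreducible[OF p(1)] unit(1) by (simp add: mahler_measure_of_def p_def M_def)
  have M1: "M \<ge> 1" unfolding M_def by (intro prod_ge_1) auto
  obtain c D where c: "c > 0" and D: "D > 0" and conc: "\<And>K. K \<ge> 1 \<Longrightarrow> \<exists>n\<ge>1. \<exists>T\<subseteq>set_pmf (sign_sum_pmf lam n).
           measure (measure_pmf (sign_sum_pmf lam n)) T \<ge> c \<and>
           real (card (set_pmf (sign_sum_pmf lam n))) \<le> D * M ^ n \<and>
           real (card T) \<le> 2 / (c\<^sup>2 * real K) * (D * M ^ n)"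
    using concentration_of_sign_sums[OF p(1) unit hyp lam] unfolding M_def by blast
  \<comment> \<open>the entropy gain \<open>c * A\<close> has to beat the excess \<open>1 + log 2 D\<close> in the trivial bound\<close>
  define A where "A = (2 + \<bar>log 2 D\<bar>) / c"
  obtain K :: nat where K: "2 powr A * 2 / c\<^sup>2 < real K" using reals_Archimedean2 by blast
  have K0: "real K > 0" using K c by (smt (verit) divide_nonneg_pos powr_ge_zero zero_less_power mult_nonneg_nonneg)
  then have K1: "K \<ge> 1" by simp
  obtain n T where n: "n \<ge> 1" and T: "T \<subseteq> set_pmf (sign_sum_pmf lam n)"
    "measure (measure_pmf (sign_sum_pmf lam n)) T \<ge> c"
    "real (card (set_pmf (sign_sum_pmf lam n))) \<le> D * M ^ n"
    "real (card T) \<le> 2 / (c\<^sup>2 * real K) * (D * M ^ n)"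
    using conc[OF K1] by blast
  let ?b = "2 / (c\<^sup>2 * real K) * (D * M ^ n)" and ?a = "D * M ^ n"
  have a: "?a > 0" using D M1 by simp
  have b: "?b > 0" using D M1 c K0 by simp
  have "x / (2 / (c\<^sup>2 * real K) * x) = c\<^sup>2 * real K / 2" if "x > 0" for x
    using that c K0 by (simp add: field_simps)
  from this[OF a] have ab: "?a / ?b = c\<^sup>2 * real K / 2" .
  have "2 powr A < c\<^sup>2 * real K / 2" using K c by (simp add: field_simps)
  then have gain: "log 2 (?a / ?b) > A" unfolding ab using c K0 by (subst less_log_iff) auto
  have A0: "A \<ge> 0" using c by (simp add: A_def)
  have "shannon_entropy (sign_sum_pmf lam n)
      \<le> 1 + log 2 ?a - measure (measure_pmf (sign_sum_pmf lam n)) T * log 2 (?a / ?b)"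
    by (rule shannon_entropy_le_two_level[OF finite_set_sign_sum_pmf order.refl T(1) a T(3) b T(4)])
  also have "\<dots> \<le> 1 + log 2 ?a - c * A"
    using mult_mono[OF T(2) less_imp_le[OF gain]] A0 by simp
  also have "c * A = 2 + \<bar>log 2 D\<bar>" using c by (simp add: A_def)
  also have "log 2 ?a = log 2 D + real n * log 2 M" using D M1 by (simp add: log_mult log_nat_power)
  finally have "shannon_entropy (sign_sum_pmf lam n) < real n * log 2 M" by linarith
  then have "shannon_entropy (sign_sum_pmf lam n) / real n < log 2 M"
    using n by (simp add: divide_less_eq mult.commute)
  then show ?thesis using entropy_rate_le[OF n, of lam] unfolding M by linarith
qed

end
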